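(* There exist constants $\zeta,\eta>0$ such that for any $A>0$ and $\lambda\in\mathbb{R}$, if $\mathcal{C}_1$ is the largest component of $D(n,p)$ for $p=n^{-1}+\lambda n^{-4/3}$, then, provided $n$ is sufficiently large with respect to $A$ and $\lambda$, $$\mathbb{P}\left(|\mathcal{C}_1|>A n^{1/3}\right)\le \zeta\, e^{-\eta A^{3/2}+\lambda^+A},$$ where $\lambda^+=\max(\lambda,0)$.
   Context: $D(n,p)$ is the random digraph on vertex set $[n]=\{1,\dots,n\}$ in which each of the $n(n-1)$ possible directed edges (ordered pairs of distinct vertices) is included with probability $p$ independently of all others. "Component" means strongly connected component; $|\mathcal{C}_1|$ is the number of vertices of a largest strongly connected component. *)

theory Defs
  imports "HOL-Probability.Probability" "Graph_Theory.Digraph_Component"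
begin

definition possible_arcs :: "nat \<Rightarrow> (nat \<times> nat) set" where
  "possible_arcs n = {(u, v). u \<in> {1..n} \<and> v \<in> {1..n} \<and> u \<noteq> v}"

(* The law of D(n,p). The default value False of Pi_pmf only concerns pairs that are
   not possible arcs. bernoulli_pmf truncates its parameter to [0,1], so p has its
   usual meaning only when 0 \<le> p \<le> 1. *)
definition random_digraph :: "nat \<Rightarrow> real \<Rightarrow> nat pair_pre_digraph pmf" where
  "random_digraph n p =
     map_pmf (\<lambda>present. \<lparr> pverts = {1..n}, parcs = {e \<in> possible_arcs n. present e} \<rparr>)
       (Pi_pmf (possible_arcs n) False (\<lambda>_. bernoulli_pmf p))"

(* |C_1|: a largest component need not be unique, but its number of vertices is.
   Meaningful for finite digraphs with at least one vertex. *)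
definition largest_scc_size :: "'a pair_pre_digraph \<Rightarrow> nat" where
  "largest_scc_size G = Max ((\<lambda>C. card (verts C)) ` pre_digraph.sccs (with_proj G))"

end

theory Submission
  imports Defs "HOL-Real_Asymp.Real_Asymp"
begin

text \<open>
  Write \<open>p = (1 + \<lambda> / s) / n\<close> with \<open>s = n\<^sup>1\<^sup>/\<^sup>3\<close>. If \<open>\<lambda> > \<epsilon> sqrt A\<close> or \<open>A < 1\<close> the bound exceeds \<open>1\<close>;
  otherwise, by monotonicity in \<open>p\<close>, one may take \<open>\<lambda> = \<epsilon> sqrt A\<close>. Let \<open>S\<close> be a strongly connected set
  of \<open>l > A s\<close> vertices and put \<open>K = \<delta> sqrt A s\<^sup>2\<close> for a small constant \<open>\<delta>\<close>.

  If \<open>S\<close> reaches more than \<open>K\<close> vertices, then so does each \<open>v \<in> S\<close>, and \<open>v\<close> receives an arc from one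
  of the vertices that it reaches. Arcs into \<open>v\<close> are independent of the set \<open>R\<close> reached from \<open>v\<close>, so
  the expected number of such \<open>v\<close> is at most \<open>n p\<close> times the expectation of \<open>|R|\<close> on
  \<open>|R| > K\<close>, which a supermartingale for the exploration of \<open>R\<close> bounds by
  \<open>C s exp (- c A\<^sup>3\<^sup>/\<^sup>2)\<close>; divide by \<open>A s\<close>.

  If \<open>S\<close> reaches at most \<open>K\<close> vertices, an event independent of the arcs inside \<open>S\<close>, the exploration
  started from \<open>l\<close> vertices must die out early, which has probability at most
  \<open>exp (- l\<^sup>2 / (4 K))\<close>. With \<open>L = l / s\<close>, the expected number of strongly connected sets of size \<open>l\<close> is at most
  \<open>exp (5 L\<^sup>3\<^sup>/\<^sup>2) / l\<close>, because the union of an in-tree and an out-tree with a common root is determined by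
  a linear forest and few additional arcs. As \<open>\<delta>\<close> is small, the first factor wins.
\<close>

section \<open>The size of an exploration\<close>

text \<open>The number of vertices reached by an exploration in which \<open>N\<close> vertices are still to be
  processed and \<open>q\<close> of these are already known to be reachable: one of the \<open>q\<close> is processed, which
  makes a binomial number of the \<open>N - q\<close> others reachable.\<close>

primrec reach_pmf :: "real \<Rightarrow> nat \<Rightarrow> nat \<Rightarrow> nat pmf" where
  "reach_pmf p 0 q = return_pmf 0"
| "reach_pmf p (Suc N) q =
     (if q = 0 then return_pmf 0
      else bind_pmf (binomial_pmf (Suc N - q) p) (\<lambda>j. map_pmf Suc (reach_pmf p N (q - 1 + j))))"

lemma finite_set_reach_pmf [simp]: "0 \<le> p \<Longrightarrow> p \<le> 1 \<Longrightarrow> finite (set_pmf (reach_pmf p N q))"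
proof (induction N arbitrary: q)
  case (Suc N)
  have "finite (set_pmf (binomial_pmf (Suc N - q) p))"
    using Suc.prems by (simp add: set_pmf_binomial_eq)
  then show ?case using Suc by simp
qed simp

lemma reach_pmf_0 [simp]: "reach_pmf p N 0 = return_pmf 0"
  by (cases N) auto

lemma expectation_reach_pmf_Suc:
  fixes h :: "nat \<Rightarrow> real"
  assumes "0 \<le> p" "p \<le> 1"
  shows "measure_pmf.expectation (reach_pmf p (Suc N) (Suc q)) h =
    (\<Sum>j\<le>N - q. pmf (binomial_pmf (N - q) p) j *
       measure_pmf.expectation (reach_pmf p N (q + j)) (\<lambda>t. h (Suc t)))"
proof -
  have "set_pmf (binomial_pmf (N - q) p) \<subseteq> {..N - q}"
    using set_pmf_binomial_eq[of p "N-q"] assms by auto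
  then have "measure_pmf.expectation (binomial_pmf (N - q) p \<bind> (\<lambda>j. map_pmf Suc (reach_pmf p N (q + j)))) h =
    (\<Sum>j\<le>N - q. pmf (binomial_pmf (N - q) p) j *\<^sub>R measure_pmf.expectation (map_pmf Suc (reach_pmf p N (q + j))) h)"
    using assms by (intro pmf_expectation_bind) auto
  then show ?thesis by simp
qed

section \<open>Generating function and mean of the binomial law\<close>

lemma sum_binomial_pmf_power:
  assumes "0 \<le> p" "p \<le> 1"
  shows "(\<Sum>j\<le>u. pmf (binomial_pmf u p) j * y ^ j) = (1 - p + p * y) ^ u"
proof -
  have "(\<Sum>j\<le>u. pmf (binomial_pmf u p) j * y ^ j) = (\<Sum>j\<le>u. real (u choose j) * (p * y)^j * (1 - p)^(u - j))"
    using assms by (intro sum.cong) (auto simp: power_mult_distrib)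
  also have "\<dots> = (p * y + (1 - p)) ^ u" by (simp add: binomial_ring)
  finally show ?thesis by (simp add: algebra_simps)
qed

lemma sum_binomial_pmf:
  assumes "0 \<le> p" "p \<le> 1"
  shows "(\<Sum>j\<le>u. pmf (binomial_pmf u p) j) = 1"
  using sum_binomial_pmf_power[OF assms, of u 1] by simp

lemma sum_binomial_pmf_mult:
  assumes "0 \<le> p" "p \<le> 1"
  shows "(\<Sum>j\<le>u. pmf (binomial_pmf u p) j * real j) = real u * p"
  using sum_k_Bernstein[of u p] assms by (simp add: Bernstein_def mult_ac)

section \<open>Lower tail of the exploration size, and its mean in the subcritical range\<close>

text \<open>With \<open>q\<close> the number of vertices waiting to be processed, the weight \<open>exp (- \<theta> q)\<close> grows
  in expectation by a factor of at most \<open>exp c\<close> per step, as long as \<open>q\<close> is small enough for the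
  exploration to end within \<open>b\<close> steps.\<close>

lemma prob_reach_pmf_atMost_le:
  assumes p: "0 \<le> p" "p \<le> 1" and th: "0 \<le> \<theta>" and c: "0 \<le> c"
    and cc: "\<theta> - p * real (N - b) * (1 - exp (-\<theta>)) \<le> c" and b: "b \<le> N" "q \<le> N"
  shows "measure_pmf.prob (reach_pmf p N q) {..b} \<le> exp (- \<theta> * real q + c * real b)"
  using b cc
\<comment> \<open>The difference \<open>N - b\<close> is constant along the recursion, so the single
  condition \<open>cc\<close> on \<open>c\<close> serves at every step.\<close>
proof (induction b arbitrary: N q)
  case 0
  show ?case
  proof (cases q)
    case 0
    then show ?thesis by simp
  next
    case (Suc q')
    with 0 obtain N' where N: "N = Suc N'" by (cases N) auto
    have "measure_pmf.prob (reach_pmf p N q) {..0} = 0"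
      unfolding measure_pmf_zero_iff using Suc N by auto
    then show ?thesis by simp
  qed
next
  case (Suc b)
  then obtain M where N: "N = Suc M" by (cases N) auto
  show ?case
  proof (cases q)
    case 0
    then show ?thesis using c by simp
  next
    case (Suc q')
    have q': "q' \<le> M" using Suc \<open>q \<le> N\<close> N by auto
    let ?P = "\<lambda>j. measure_pmf.prob (reach_pmf p M (q' + j)) {..b}"
    have eq: "measure_pmf.prob (reach_pmf p N q) {..Suc b} =
        (\<Sum>j\<le>M - q'. pmf (binomial_pmf (M - q') p) j * ?P j)"
    proof -
      have "measure_pmf.prob (reach_pmf p N q) {..Suc b}
          = measure_pmf.expectation (reach_pmf p (Suc M) (Suc q')) (indicator {..Suc b})"
        using Suc N by simp
      also have "\<dots> = (\<Sum>j\<le>M - q'. pmf (binomial_pmf (M - q') p) j *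
        measure_pmf.expectation (reach_pmf p M (q' + j)) (\<lambda>t. indicator {..Suc b} (Suc t)))"
        by (rule expectation_reach_pmf_Suc[OF p])
      also have "(\<lambda>t. indicator {..Suc b} (Suc t) :: real) = indicator {..b}"
        by (auto simp: indicator_def)
      finally show ?thesis by simp
    qed
    have IH: "?P j \<le> exp (- \<theta> * real (q' + j) + c * real b)" if "j \<le> M - q'" for j
      using Suc.IH[of M "q' + j"] that q' Suc.prems N by auto
    have "measure_pmf.prob (reach_pmf p N q) {..Suc b} \<le>
      (\<Sum>j\<le>M - q'. pmf (binomial_pmf (M - q') p) j * (exp (- \<theta> * real q' + c * real b) * exp (-\<theta>)^j))"
      unfolding eq
    proof (intro sum_mono mult_left_mono)
      fix j assume "j \<in> {..M - q'}"
      then have "?P j \<le> exp (- \<theta> * real (q' + j) + c * real b)" using IH by simp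
      also have "\<dots> = exp (- \<theta> * real q' + c * real b) * exp (-\<theta>)^j"
        by (simp add: exp_of_nat_mult[symmetric] exp_add[symmetric] algebra_simps)
      finally show "?P j \<le> exp (- \<theta> * real q' + c * real b) * exp (-\<theta>)^j" .
    qed simp
    also have "\<dots> = exp (- \<theta> * real q' + c * real b) * (1 - p + p * exp (-\<theta>)) ^ (M - q')"
      unfolding sum_binomial_pmf_power[OF p, of "M - q'" "exp (-\<theta>)", symmetric]
      by (simp add: sum_distrib_left mult_ac)
    finally have *: "measure_pmf.prob (reach_pmf p N q) {..Suc b} \<le>
       exp (- \<theta> * real q' + c * real b) * (1 - p + p * exp (-\<theta>)) ^ (M - q')" .
    show ?thesis
    proof (cases "q' \<le> b")
      case True
      have e: "1 - exp (-\<theta>) \<ge> 0" using th by simp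
      have "(1 - p + p * exp (-\<theta>)) ^ (M - q') \<le> exp (- p * (1 - exp (-\<theta>))) ^ (M - q')"
      proof (intro power_mono)
        show "1 - p + p * exp (- \<theta>) \<le> exp (- p * (1 - exp (- \<theta>)))"
          using exp_ge_add_one_self[of "- p * (1 - exp (-\<theta>))"] by (simp add: algebra_simps)
        show "0 \<le> 1 - p + p * exp (- \<theta>)" using p by simp
      qed
      also have "\<dots> = exp (- p * (1 - exp (-\<theta>)) * real (M - q'))"
        by (simp add: exp_of_nat_mult[symmetric] mult_ac)
      \<comment> \<open>Because \<open>q' \<le> b\<close>, at least \<open>M - b\<close> vertices
        are still unseen, and \<open>M - b = N - Suc b\<close> is the number that occurs in
        \<open>cc\<close>.\<close>
      also have "\<dots> \<le> exp (- (p * real (M - b) * (1 - exp (-\<theta>))))"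
      proof -
        have "p * (1 - exp (-\<theta>)) * real (M - b) \<le> p * (1 - exp (-\<theta>)) * real (M - q')"
          using True p e by (intro mult_left_mono) auto
        then show ?thesis by (simp add: algebra_simps)
      qed
      also have "\<dots> \<le> exp (c - \<theta>)" using Suc.prems N by simp
      finally have "measure_pmf.prob (reach_pmf p N q) {..Suc b} \<le>
         exp (- \<theta> * real q' + c * real b) * exp (c - \<theta>)"
        using * by (meson dual_order.trans exp_ge_zero mult_left_mono)
      also have "\<dots> = exp (- \<theta> * real q + c * real (Suc b))"
        using Suc by (simp add: exp_add[symmetric] algebra_simps)
      finally show ?thesis .
    next
      case False
      \<comment> \<open>Every queued vertex is eventually processed and counted, so a queue longer
        than \<open>Suc b\<close> rules out a size of at most \<open>Suc b\<close>.\<close>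
      have gen: "t \<ge> r" if "r \<le> K" "t \<in> set_pmf (reach_pmf p K r)" for K r t
        using that
      proof (induction K arbitrary: r t)
        case (Suc K)
        show ?case
        proof (cases "r = 0")
          case False
          with Suc.prems obtain j t' where j: "j \<in> set_pmf (binomial_pmf (Suc K - r) p)"
            and t': "t' \<in> set_pmf (reach_pmf p K (r - 1 + j))" "t = Suc t'"
            by auto
          have "j \<le> Suc K - r" using j set_pmf_binomial_eq[of p "Suc K - r"] p by (auto split: if_splits)
          then have "t' \<ge> r - 1 + j" using Suc.IH[of "r - 1 + j" t'] t' Suc.prems False by auto
          then show ?thesis using t' by simp
        qed simp
      qed simp
      have "measure_pmf.prob (reach_pmf p N q) {..Suc b} = 0"
        unfolding measure_pmf_zero_iff using gen[of q N] Suc.prems False Suc by fastforce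
      then show ?thesis by simp
    qed
  qed
qed

text \<open>Comparison with a subcritical branching process: a waiting vertex has at most N p
  children on average, hence total progeny at most 1 + N p + (N p)^2 + ... In the induction, the
  bound for one vertex fewer is weakened to the current denominator.\<close>

lemma expectation_reach_pmf_le:
  assumes p: "0 \<le> p" "p \<le> 1" and Np: "real N * p < 1" and q: "q \<le> N"
  shows "measure_pmf.expectation (reach_pmf p N q) real \<le> real q / (1 - real N * p)"
  using q Np
proof (induction N arbitrary: q)
  case (Suc N)
  show ?case
  proof (cases q)
    case 0
    then show ?thesis using Suc.prems by simp
  next
    case (Suc r)
    let ?d = "1 - real (Suc N) * p"
    have d: "?d > 0" "1 - real N * p \<ge> ?d" using Suc.prems p by (auto simp: algebra_simps)
    have "measure_pmf.expectation (reach_pmf p (Suc N) q) real = (\<Sum>j\<le>N - r. pmf (binomial_pmf (N - r) p) j *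
       (1 + measure_pmf.expectation (reach_pmf p N (r + j)) real))"
      using expectation_reach_pmf_Suc[OF p, of N r real] Suc p
      by (simp add: integrable_measure_pmf_finite algebra_simps)
    also have "\<dots> \<le> (\<Sum>j\<le>N - r. pmf (binomial_pmf (N - r) p) j * ((1 + real r / ?d) + real j / ?d))"
    proof (intro sum_mono mult_left_mono)
      fix j assume j: "j \<in> {..N - r}"
      have "measure_pmf.expectation (reach_pmf p N (r + j)) real \<le> real (r + j) / (1 - real N * p)"
        using j Suc Suc.prems d p by (intro Suc.IH) auto
      also have "\<dots> \<le> real (r + j) / ?d" using d by (intro divide_left_mono mult_pos_pos) auto
      finally show "1 + measure_pmf.expectation (reach_pmf p N (r + j)) real \<le> (1 + real r / ?d) + real j / ?d"
        by (simp add: add_divide_distrib)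
    qed simp
    also have "\<dots> = 1 + real r / ?d + real (N - r) * p / ?d"
      using sum_binomial_pmf[OF p, of "N - r"] sum_binomial_pmf_mult[OF p, of "N - r"]
      by (simp only: distrib_left sum.distrib times_divide_eq_right flip: sum_distrib_right sum_divide_distrib)
    also have "\<dots> \<le> 1 + real r / ?d + (real (Suc N) * p) / ?d"
      using d p by (intro add_left_mono divide_right_mono mult_right_mono) auto
    also have "\<dots> = real q / ?d"
    proof -
      have "1 + x / d + (1 - d) / d = (x + 1) / d" if "d > 0" for x d :: real
        using that by (simp add: field_simps)
      from this[OF d(1), of "real r"] show ?thesis using Suc by (simp add: add.commute)
    qed
    finally show ?thesis .
  qed
qed auto

section \<open>Expected excess of the exploration over a given size\<close>

text \<open>The weight \<open>g q = exp (a q) - exp (- b q)\<close> vanishes when the exploration stops, and the choice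
  \<open>b > a\<close> compensates an initial upward drift of the queue length.\<close>

lemma binomial_step_le:
  assumes p: "0 \<le> p" "p \<le> 1" and ab: "0 \<le> a" "0 \<le> b" and zb: "p * b \<le> 1/2"
    and u: "u \<le> M" "M \<le> n" and n: "real n * p * (exp a - exp (-b)) + 2 * real n * p^2 * b^2 \<le> a + b"
  shows "(\<Sum>j\<le>u. pmf (binomial_pmf u p) j * (exp (a * real (q + j)) - exp (- b * real (q + j))))
    \<le> exp (- a + real M * p * (exp a - 1)) * (exp (a * real (Suc q)) - exp (- b * real (Suc q)))"
proof -
  have "(\<Sum>j\<le>u. pmf (binomial_pmf u p) j * (exp (a * real (q + j)) - exp (- b * real (q + j))))
    = exp (a * real q) * (\<Sum>j\<le>u. pmf (binomial_pmf u p) j * exp a ^ j)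
      - exp (- b * real q) * (\<Sum>j\<le>u. pmf (binomial_pmf u p) j * exp (-b) ^ j)"
    unfolding sum_distrib_left sum_subtractf[symmetric]
    by (intro sum.cong) (auto simp: algebra_simps exp_of_nat_mult[symmetric] exp_add[symmetric])
  also have "\<dots> = exp (a * real q) * (1 - p + p * exp a) ^ u - exp (- b * real q) * (1 - p + p * exp (-b)) ^ u"
    using sum_binomial_pmf_power[OF p] by simp
  finally have eq: "(\<Sum>j\<le>u. pmf (binomial_pmf u p) j * (exp (a * real (q + j)) - exp (- b * real (q + j))))
    = exp (a * real q) * (1 - p + p * exp a) ^ u - exp (- b * real q) * (1 - p + p * exp (-b)) ^ u" .
  let ?\<rho> = "exp (real M * p * (exp a - 1))"
  have ea: "exp a - 1 \<ge> 0" using ab by simp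
  have A: "(1 - p + p * exp a) ^ u \<le> ?\<rho>"
  proof -
    have "(1 - p + p * exp a) ^ u \<le> exp (p * (exp a - 1)) ^ u"
    proof (rule power_mono)
      show "1 - p + p * exp a \<le> exp (p * (exp a - 1))"
        using exp_ge_add_one_self[of "p * (exp a - 1)"] by (simp add: algebra_simps)
    qed (use p in auto)
    also have "\<dots> = exp (real u * (p * (exp a - 1)))" by (simp add: exp_of_nat_mult)
    also have "\<dots> \<le> ?\<rho>" unfolding mult.assoc[symmetric] using u p ea
      by (intro iffD2[OF exp_le_cancel_iff] mult_right_mono) auto
    finally show ?thesis .
  qed
  \<comment> \<open>This term is subtracted, so it needs a lower bound. The estimate ln (1 - z) >= -
    z - 2 z^2 with z <= p b accounts for the summand 2 n p^2 b^2 in the assumption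
    \<open>n\<close>.\<close>
  have B: "exp (- a - b) * ?\<rho> \<le> (1 - p + p * exp (-b)) ^ u"
  proof -
    define z where "z = p * (1 - exp (-b))"
    have eb: "1 - exp (-b) \<le> b" using exp_ge_add_one_self[of "-b"] by simp
    have eb0: "1 - exp (-b) \<ge> 0" using ab by simp
    have z: "0 \<le> z" "z \<le> p * b" "z \<le> 1/2"
      using eb eb0 p zb mult_left_mono[OF eb p(1)] unfolding z_def by auto
    have ln: "- z - 2 * z^2 \<le> ln (1 - z)"
      using ln_one_minus_pos_lower_bound[of z] z by (simp add: power2_eq_square)
    have 1: "exp (- z - 2 * z^2) \<le> 1 - z"
      using ln z by (subst ln_ge_iff[symmetric]) auto
    have "real M * p * (exp a - 1) + real M * (z + 2 * z^2) \<le> real n * p * (exp a - 1) + real n * (z + 2 * z^2)"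
      using u p ea z by (intro add_mono mult_right_mono) auto
    also have "\<dots> = real n * p * (exp a - exp (-b)) + 2 * real n * z^2"
      unfolding z_def by (simp add: algebra_simps)
    also have "\<dots> \<le> real n * p * (exp a - exp (-b)) + 2 * real n * (p * b)^2"
      using z by (intro add_left_mono mult_left_mono power_mono) auto
    also have "\<dots> \<le> a + b" using n by (simp add: power_mult_distrib mult.assoc)
    finally have "exp (- a - b) * ?\<rho> \<le> exp (real M * (- z - 2 * z^2))"
      by (simp add: exp_add[symmetric] algebra_simps)
    also have "\<dots> \<le> exp (real u * (- z - 2 * z^2))"
    proof -
      have "- z - 2 * z^2 \<le> 0" using z(1) zero_le_power2[of z] by linarith
      then show ?thesis using u by (intro iffD2[OF exp_le_cancel_iff] mult_right_mono_neg) auto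
    qed
    also have "\<dots> = exp (- z - 2 * z^2) ^ u" by (simp add: exp_of_nat_mult)
    also have "\<dots> \<le> (1 - z) ^ u" using 1 by (intro power_mono) auto
    finally show ?thesis by (simp add: z_def algebra_simps)
  qed
  have "exp (a * real q) * (1 - p + p * exp a) ^ u - exp (- b * real q) * (1 - p + p * exp (-b)) ^ u
    \<le> exp (a * real q) * ?\<rho> - exp (- b * real q) * (exp (- a - b) * ?\<rho>)"
    using A B by (intro diff_mono mult_left_mono) auto
  also have "\<dots> = exp (- a + real M * p * (exp a - 1)) * (exp (a * real (Suc q)) - exp (- b * real (Suc q)))"
    by (simp add: exp_add exp_diff exp_minus field_simps)
  finally show ?thesis using eq by simp
qed

text \<open>The truncated difference \<open>t - k\<close> counts the vertices processed after the
  first \<open>k\<close> steps. Along these steps \<open>binomial_step_le\<close> is applied with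
  one vertex fewer each time. On the remaining \<open>N\<close> vertices the exploration is
  subcritical, and a q <= exp (a q) - exp (- b q) turns the bound on its mean into a multiple of the
  weight.\<close>

lemma expectation_reach_pmf_excess_le:
  assumes p: "0 \<le> p" "p \<le> 1" and ab: "0 < a" "0 \<le> b" and zb: "p * b \<le> 1/2"
    and n: "real n * p * (exp a - exp (-b)) + 2 * real n * p^2 * b^2 \<le> a + b"
    and Np: "real N * p < 1" and q: "q \<le> N + k" "N + k \<le> n"
  shows "measure_pmf.expectation (reach_pmf p (N + k) q) (\<lambda>t. real (t - k))
    \<le> exp (\<Sum>i<k. - a + real (N + i) * p * (exp a - 1)) * (exp (a * real q) - exp (- b * real q))
        / (a * (1 - real N * p))"
  using q
proof (induction k arbitrary: q)
  case 0
  have "measure_pmf.expectation (reach_pmf p N q) real \<le> real q / (1 - real N * p)"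
    using expectation_reach_pmf_le[OF p Np, of q] 0 by simp
  also have "\<dots> = (a * real q) / (a * (1 - real N * p))" using ab by simp
  also have "\<dots> \<le> (exp (a * real q) - exp (- b * real q)) / (a * (1 - real N * p))"
  proof (intro divide_right_mono)
    show "a * real q \<le> exp (a * real q) - exp (- b * real q)"
      using exp_ge_add_one_self[of "a * real q"] ab by (smt (verit) exp_le_one_iff mult_nonneg_nonneg of_nat_0_le_iff mult_minus_left)
    show "0 \<le> a * (1 - real N * p)" using ab Np by simp
  qed
  finally show ?case by simp
next
  case (Suc k)
  let ?g = "\<lambda>q. exp (a * real q) - exp (- b * real q)"
  let ?D = "exp (\<Sum>i<k. - a + real (N + i) * p * (exp a - 1)) / (a * (1 - real N * p))"
  have D: "?D \<ge> 0" using ab Np by simp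
  show ?case
  proof (cases q)
    case 0
    then show ?thesis by simp
  next
    case (Suc r)
    have "measure_pmf.expectation (reach_pmf p (N + Suc k) q) (\<lambda>t. real (t - Suc k)) =
      (\<Sum>j\<le>N + k - r. pmf (binomial_pmf (N + k - r) p) j *
         measure_pmf.expectation (reach_pmf p (N + k) (r + j)) (\<lambda>t. real (t - k)))"
      using expectation_reach_pmf_Suc[OF p, of "N + k" r "\<lambda>t. real (t - Suc k)"] Suc by simp
    also have "\<dots> \<le> (\<Sum>j\<le>N + k - r. pmf (binomial_pmf (N + k - r) p) j * (?D * ?g (r + j)))"
    proof (intro sum_mono mult_left_mono)
      fix j assume "j \<in> {..N + k - r}"
      then show "measure_pmf.expectation (reach_pmf p (N + k) (r + j)) (\<lambda>t. real (t - k)) \<le> ?D * ?g (r + j)"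
        using Suc.IH[of "r + j"] Suc.prems Suc by auto
    qed simp
    also have "\<dots> = ?D * (\<Sum>j\<le>N + k - r. pmf (binomial_pmf (N + k - r) p) j * ?g (r + j))"
      by (simp add: sum_distrib_left mult_ac)
    also have "\<dots> \<le> ?D * (exp (- a + real (N + k) * p * (exp a - 1)) * ?g (Suc r))"
      using Suc.prems ab by (intro mult_left_mono[OF _ D] binomial_step_le[OF p _ _ zb _ _ n]) auto
    also have "\<dots> = exp (\<Sum>i<Suc k. - a + real (N + i) * p * (exp a - 1)) * ?g q / (a * (1 - real N * p))"
      using Suc by (simp add: exp_add mult_ac)
    finally show ?thesis .
  qed
qed

section \<open>Independent arcs\<close>

abbreviation bernoulli_family :: "'a set \<Rightarrow> real \<Rightarrow> ('a \<Rightarrow> bool) pmf" where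
  "bernoulli_family I p \<equiv> Pi_pmf I False (\<lambda>_. bernoulli_pmf p)"

lemma set_bernoulli_family: "finite I \<Longrightarrow> \<omega> \<in> set_pmf (bernoulli_family I p) \<Longrightarrow> \<omega> e \<Longrightarrow> e \<in> I"
  using set_Pi_pmf_subset[of I False "\<lambda>_. bernoulli_pmf p"] by auto

lemma finite_set_bernoulli_family [simp]:
  assumes "finite I" shows "finite (set_pmf (bernoulli_family I p))"
proof (rule finite_subset)
  show "set_pmf (bernoulli_family I p) \<subseteq> (\<lambda>A e. e \<in> A) ` Pow I"
  proof
    fix \<omega> assume "\<omega> \<in> set_pmf (bernoulli_family I p)"
    then have "Collect \<omega> \<in> Pow I" using set_bernoulli_family[OF assms] by auto
    moreover have "\<omega> = (\<lambda>e. e \<in> Collect \<omega>)" by auto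
    ultimately show "\<omega> \<in> (\<lambda>A e. e \<in> A) ` Pow I" by blast
  qed
qed (use assms in auto)

text \<open>Samples are \<open>False\<close> off their index set, so pointwise disjunction glues
  samples over disjoint sets.\<close>

lemma bernoulli_family_union:
  assumes "finite A" "finite B" "A \<inter> B = {}"
  shows "bernoulli_family (A \<union> B) p =
    bind_pmf (bernoulli_family A p) (\<lambda>f. map_pmf (\<lambda>g x. f x \<or> g x) (bernoulli_family B p))"
proof -
  have "bernoulli_family (A \<union> B) p =
     bind_pmf (bernoulli_family A p) (\<lambda>f. map_pmf (\<lambda>g x. if x \<in> A then f x else g x) (bernoulli_family B p))"
    unfolding Pi_pmf_union[OF assms]
    by (simp add: pair_pmf_def map_pmf_def bind_assoc_pmf bind_return_pmf)
  also have "\<dots> = bind_pmf (bernoulli_family A p) (\<lambda>f. map_pmf (\<lambda>g x. f x \<or> g x) (bernoulli_family B p))"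
  proof (intro bind_pmf_cong map_pmf_cong refl ext)
    fix f g x assume "f \<in> set_pmf (bernoulli_family A p)" "g \<in> set_pmf (bernoulli_family B p)"
    then show "(if x \<in> A then f x else g x) = (f x \<or> g x)"
      using set_bernoulli_family[OF assms(1), of f p x] set_bernoulli_family[OF assms(2), of g p x] assms(3) by auto
  qed
  finally show ?thesis .
qed

text \<open>Dependence on the coordinates in \<open>A\<close> alone is expressed as invariance under
  setting all others to \<open>False\<close>. The family is a product over
  \<open>I \<inter> A\<close> and \<open>I - A\<close>; taking \<open>I - A\<close> in place of
  \<open>I \<inter> B\<close> makes the two blocks exhaust \<open>I\<close>.\<close>

lemma prob_bernoulli_family_indep:
  assumes "finite I" "A \<inter> B = {}"
    and P: "\<And>\<omega>. P \<omega> \<longleftrightarrow> P (\<lambda>e. e \<in> A \<and> \<omega> e)"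
    and Q: "\<And>\<omega>. Q \<omega> \<longleftrightarrow> Q (\<lambda>e. e \<in> B \<and> \<omega> e)"
  shows "measure_pmf.prob (bernoulli_family I p) {\<omega>. P \<omega> \<and> Q \<omega>} =
    measure_pmf.prob (bernoulli_family I p) {\<omega>. P \<omega>} * measure_pmf.prob (bernoulli_family I p) {\<omega>. Q \<omega>}"
proof -
  let ?A = "I \<inter> A" and ?B = "I - A"
  have fin: "finite ?A" "finite ?B" "?A \<inter> ?B = {}" and I: "I = ?A \<union> ?B" using assms by auto
  have *: "bernoulli_family I p = map_pmf (\<lambda>(f, g) x. f x \<or> g x) (pair_pmf (bernoulli_family ?A p) (bernoulli_family ?B p))"
    by (subst I, subst bernoulli_family_union[OF fin])
       (simp add: pair_pmf_def map_pmf_def bind_assoc_pmf bind_return_pmf)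
  have PQ: "P (\<lambda>x. f x \<or> g x) \<longleftrightarrow> P f" "Q (\<lambda>x. f x \<or> g x) \<longleftrightarrow> Q g"
    if "f \<in> set_pmf (bernoulli_family ?A p)" "g \<in> set_pmf (bernoulli_family ?B p)" for f g
  proof -
    have "f x \<Longrightarrow> x \<in> ?A" "g x \<Longrightarrow> x \<in> ?B" for x
      using that set_bernoulli_family fin by fast+
    then have "(\<lambda>e. e \<in> A \<and> (f e \<or> g e)) = (\<lambda>e. e \<in> A \<and> f e)" "(\<lambda>e. e \<in> B \<and> (f e \<or> g e)) = (\<lambda>e. e \<in> B \<and> g e)"
      using assms(2) by (auto simp: fun_eq_iff)
    then show "P (\<lambda>x. f x \<or> g x) \<longleftrightarrow> P f" "Q (\<lambda>x. f x \<or> g x) \<longleftrightarrow> Q g"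
      using P[of "\<lambda>x. f x \<or> g x"] P[of f] Q[of "\<lambda>x. f x \<or> g x"] Q[of g] by auto
  qed
  let ?M = "pair_pmf (bernoulli_family ?A p) (bernoulli_family ?B p)"
  have prod: "measure_pmf.prob ?M {fg. P (fst fg) \<and> Q (snd fg)} =
      measure_pmf.prob (bernoulli_family ?A p) {f. P f} * measure_pmf.prob (bernoulli_family ?B p) {g. Q g}" for P Q
  proof -
    have "{fg. P (fst fg) \<and> Q (snd fg)} = {f. P f} \<times> {g. Q g}" by auto
    moreover have "measure_pmf.prob ?M (X \<times> Y) = measure_pmf.prob (bernoulli_family ?A p) X * measure_pmf.prob (bernoulli_family ?B p) Y" for X Y
    proof -
      have "measure_pmf.prob ?M (X \<times> Y) = measure_pmf.prob ?M ((X \<inter> set_pmf (bernoulli_family ?A p)) \<times> (Y \<inter> set_pmf (bernoulli_family ?B p)))"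
        by (intro measure_prob_cong_0) (auto simp: pmf_eq_0_set_pmf)
      also have "\<dots> = measure_pmf.prob (bernoulli_family ?A p) (X \<inter> set_pmf (bernoulli_family ?A p)) *
         measure_pmf.prob (bernoulli_family ?B p) (Y \<inter> set_pmf (bernoulli_family ?B p))"
        by (rule measure_pmf_prob_product) (auto intro!: countable_finite fin)
      finally show ?thesis by (simp add: measure_Int_set_pmf)
    qed
    ultimately show ?thesis by simp
  qed
  have e: "measure_pmf.prob (bernoulli_family I p) {\<omega>. R \<omega>} = measure_pmf.prob ?M {fg. R' (fst fg) \<and> R'' (snd fg)}"
    if "\<And>f g. f \<in> set_pmf (bernoulli_family ?A p) \<Longrightarrow> g \<in> set_pmf (bernoulli_family ?B p) \<Longrightarrow>
         R (\<lambda>x. f x \<or> g x) \<longleftrightarrow> R' f \<and> R'' g" for R R' R''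
    unfolding * using that by (auto simp: measure_map_pmf intro!: measure_prob_cong_0 simp: set_pmf_iff[symmetric])
  have "measure_pmf.prob (bernoulli_family I p) {\<omega>. P \<omega> \<and> Q \<omega>} = measure_pmf.prob ?M {fg. P (fst fg) \<and> Q (snd fg)}"
    by (rule e) (use PQ in auto)
  moreover have "measure_pmf.prob (bernoulli_family I p) {\<omega>. P \<omega>} = measure_pmf.prob ?M {fg. P (fst fg) \<and> True}"
    by (rule e[where R''="\<lambda>_. True"]) (use PQ in auto)
  moreover have "measure_pmf.prob (bernoulli_family I p) {\<omega>. Q \<omega>} = measure_pmf.prob ?M {fg. True \<and> Q (snd fg)}"
    by (rule e[where R'="\<lambda>_. True"]) (use PQ in auto)
  ultimately show ?thesis unfolding prod[of P Q] prod[of P "\<lambda>_. True"] prod[of "\<lambda>_. True" Q] by simp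
qed

lemma prob_bernoulli_family_subset:
  assumes "finite I" "W \<subseteq> I" "0 \<le> p" "p \<le> 1"
  shows "measure_pmf.prob (bernoulli_family I p) {\<omega>. \<forall>e\<in>W. \<omega> e} = p ^ card W"
proof -
  have "{\<omega>. \<forall>e\<in>W. \<omega> e} = Pi I (\<lambda>e. if e \<in> W then {True} else UNIV)"
    using assms(2) by (auto simp: Pi_def split: if_splits)
  then have "measure_pmf.prob (bernoulli_family I p) {\<omega>. \<forall>e\<in>W. \<omega> e}
      = (\<Prod>e\<in>I. measure_pmf.prob (bernoulli_pmf p) (if e \<in> W then {True} else UNIV))"
    using assms(1) by (simp add: measure_Pi_pmf_Pi)
  also have "\<dots> = (\<Prod>e\<in>I. if e \<in> W then p else 1)"
    using assms by (intro prod.cong) (auto simp: measure_pmf_single)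
  also have "\<dots> = p ^ card W"
    using assms by (simp add: prod.If_cases Int_absorb1)
  finally show ?thesis .
qed

section \<open>Monotone coupling in the arc probability\<close>

lemma bernoulli_pmf_thin:
  assumes "0 \<le> p" "p \<le> p'" "p' \<le> 1"
  shows "bernoulli_pmf p = map_pmf (\<lambda>(x, y). x \<and> y) (pair_pmf (bernoulli_pmf p') (bernoulli_pmf (p / p')))"
proof (cases "p' = 0")
  case True
  with assms have "p = 0" by simp
  moreover have "bernoulli_pmf 0 = return_pmf False"
  proof (rule pmf_eqI)
    fix b show "pmf (bernoulli_pmf 0) b = pmf (return_pmf False) b" by (cases b) auto
  qed
  ultimately show ?thesis using True by (simp add: pair_return_pmf1)
next
  case False
  then have q: "0 \<le> p / p'" "p / p' \<le> 1" using assms by auto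
  have "pmf (map_pmf (\<lambda>(x, y). x \<and> y) (pair_pmf (bernoulli_pmf p') (bernoulli_pmf (p / p')))) True
    = measure_pmf.prob (pair_pmf (bernoulli_pmf p') (bernoulli_pmf (p / p'))) ({True} \<times> {True})"
    unfolding pmf_map by (rule arg_cong[where f="measure _"]) auto
  also have "\<dots> = p' * (p / p')"
    using q assms by (subst measure_pmf_prob_product) (auto simp: measure_pmf_single)
  also have "\<dots> = p" using False by simp
  finally have T: "pmf (map_pmf (\<lambda>(x, y). x \<and> y) (pair_pmf (bernoulli_pmf p') (bernoulli_pmf (p / p')))) True = p" .
  have F: "pmf M False = 1 - pmf M True" for M :: "bool pmf" using pmf_False_conv_True by auto
  show ?thesis
  proof (rule pmf_eqI)
    fix b show "pmf (bernoulli_pmf p) b = pmf (map_pmf (\<lambda>(x, y). x \<and> y) (pair_pmf (bernoulli_pmf p') (bernoulli_pmf (p / p')))) b"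
      using T F assms by (cases b) auto
  qed
qed

text \<open>Coupling: each index carries two independent coins with success probabilities
  \<open>p'\<close> and \<open>p / p'\<close>. The first coins have the law for \<open>p'\<close>,
  the conjunctions of both coins have the law for \<open>p\<close>, and the latter sample lies below
  the former.\<close>

lemma prob_bernoulli_family_mono:
  assumes "finite I" "0 \<le> p" "p \<le> p'" "p' \<le> 1"
    and mono: "\<And>\<omega> \<omega>'. P \<omega> \<Longrightarrow> (\<And>e. \<omega> e \<Longrightarrow> \<omega>' e) \<Longrightarrow> P \<omega>'"
  shows "measure_pmf.prob (bernoulli_family I p) {\<omega>. P \<omega>} \<le> measure_pmf.prob (bernoulli_family I p') {\<omega>. P \<omega>}"
proof -
  have "bernoulli_family I p = map_pmf (\<lambda>f x. fst (f x) \<and> snd (f x))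
      (Pi_pmf I (False, False) (\<lambda>_. pair_pmf (bernoulli_pmf p') (bernoulli_pmf (p / p'))))"
    unfolding bernoulli_pmf_thin[OF assms(2-4)] using assms(1)
    by (subst Pi_pmf_map[where dflt="(False,False)"]) (auto simp: fun_eq_iff case_prod_beta intro!: map_pmf_cong)
  moreover have "bernoulli_family I p' = map_pmf (\<lambda>f x. fst (f x))
      (Pi_pmf I (False, False) (\<lambda>_. pair_pmf (bernoulli_pmf p') (bernoulli_pmf (p / p'))))"
  proof -
    let ?q = "pair_pmf (bernoulli_pmf p') (bernoulli_pmf (p / p'))"
    have "bernoulli_family I p' = Pi_pmf I False (\<lambda>_. map_pmf fst ?q)" by (simp add: map_fst_pair_pmf)
    also have "\<dots> = map_pmf (\<lambda>f x. fst (f x)) (Pi_pmf I (False, False) (\<lambda>_. ?q))"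
      using assms(1) by (subst Pi_pmf_map[where dflt="(False,False)"]) (auto simp: fun_eq_iff intro!: map_pmf_cong)
    finally show ?thesis .
  qed
  ultimately show ?thesis
    by (auto simp: measure_map_pmf intro!: measure_pmf.finite_measure_mono elim!: mono)
qed

section \<open>Exploration of the reachable set\<close>

text \<open>Only arcs into \<open>U\<close> are inspected, so that this set is independent of the arcs into \<open>Q\<close>.\<close>

definition reach :: "'a set \<Rightarrow> 'a set \<Rightarrow> ('a \<times> 'a \<Rightarrow> bool) \<Rightarrow> 'a set" where
  "reach Q U \<omega> = {(x, y). \<omega> (x, y) \<and> y \<in> U}\<^sup>* `` Q"

lemma reach_subset: "reach Q U \<omega> \<subseteq> Q \<union> U"
proof
  fix y assume "y \<in> reach Q U \<omega>"
  then obtain x where "x \<in> Q" "(x, y) \<in> {(x, y). \<omega> (x, y) \<and> y \<in> U}\<^sup>*" by (auto simp: reach_def)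
  then show "y \<in> Q \<union> U" by (auto elim: rtranclE)
qed

lemma reach_local:
  assumes "Q \<inter> U = {}"
  shows "reach Q U \<omega> = reach Q U (\<lambda>e. e \<in> {(x, y). x \<in> Q \<union> U \<and> y \<in> U \<and> x \<noteq> y} \<and> \<omega> e)"
proof -
  let ?E = "{(x, y). \<omega> (x, y) \<and> y \<in> U}"
  let ?F = "{(x, y). (x \<in> Q \<union> U \<and> y \<in> U \<and> x \<noteq> y) \<and> \<omega> (x, y) \<and> y \<in> U}"
  have "(x, y) \<in> ?F\<^sup>*" if "(x, y) \<in> ?E\<^sup>*" "x \<in> Q" for x y
    using that
  proof (induction rule: rtrancl_induct)
    case (step y z)
    then have "y \<in> Q \<union> U" by (auto elim: rtranclE)
    then show ?case using step by (cases "y = z") (auto intro: rtrancl_into_rtrancl)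
  qed auto
  moreover have "?F\<^sup>* \<subseteq> ?E\<^sup>*" by (rule rtrancl_mono) auto
  ultimately show ?thesis unfolding reach_def by auto
qed

text \<open>Processing \<open>x\<close> moves its unseen out-neighbours \<open>J\<close> into the
  queue. A path that enters \<open>J\<close> can be restarted there, so from then on only arcs into
  \<open>U - J\<close> have to be followed.\<close>

lemma reach_step:
  assumes "x \<in> Q" "Q \<inter> U = {}" and J: "J = {y \<in> U. \<omega> (x, y)}"
  shows "reach Q U \<omega> = insert x (reach (Q - {x} \<union> J) (U - J) \<omega>)"
proof -
  let ?E = "{(x, y). \<omega> (x, y) \<and> y \<in> U}" and ?F = "{(x, y). \<omega> (x, y) \<and> y \<in> U - J}"
  have "z \<in> insert x (reach (Q - {x} \<union> J) (U - J) \<omega>)" if "(y, z) \<in> ?E\<^sup>*" "y \<in> Q" for y z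
    using that
  proof (induction rule: rtrancl_induct)
    case (step z w)
    show ?case
    proof (cases "w \<in> J")
      case True
      then show ?thesis by (auto simp: reach_def)
    next
      case False
      \<comment> \<open>An arc from \<open>x\<close> into \<open>U\<close> ends in \<open>J\<close>,
        while \<open>w\<close> lies outside \<open>J\<close>.\<close>
      then have "z \<noteq> x" using step J by auto
      then obtain y' where "y' \<in> Q - {x} \<union> J" "(y', z) \<in> ?F\<^sup>*" using step by (auto simp: reach_def)
      moreover have "(z, w) \<in> ?F" using False step by auto
      ultimately have "(y', w) \<in> ?F\<^sup>*" by (meson rtrancl.rtrancl_into_rtrancl)
      then show ?thesis using \<open>y' \<in> _\<close> by (auto simp: reach_def)
    qed
  qed (auto simp: reach_def)
  moreover have "z \<in> reach Q U \<omega>" if "z \<in> reach (Q - {x} \<union> J) (U - J) \<omega>" for z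
  proof -
    from that obtain y where y: "y \<in> Q - {x} \<union> J" "(y, z) \<in> ?F\<^sup>*" by (auto simp: reach_def)
    have "(y, z) \<in> ?E\<^sup>*" using y(2) rtrancl_mono[of ?F ?E] by auto
    moreover have "y \<in> Q \<or> (x, y) \<in> ?E" using y J by auto
    ultimately show ?thesis using assms(1) by (auto simp: reach_def intro: converse_rtrancl_into_rtrancl)
  qed
  moreover have "x \<in> reach Q U \<omega>" using assms(1) by (auto simp: reach_def)
  moreover have "z \<in> reach Q U \<omega> \<Longrightarrow> \<exists>y\<in>Q. (y, z) \<in> ?E\<^sup>*" for z by (auto simp: reach_def)
  ultimately show ?thesis by blast
qed

text \<open>The arcs from one queued vertex \<open>x\<close> into \<open>U\<close> are exposed
  first. They yield a binomial number of new vertices, and the rest of the exploration uses no arc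
  that leaves \<open>x\<close>. The index set \<open>I\<close> is only bounded from below because
  the exposed arcs are removed from it in the induction.\<close>

lemma card_reach_distr:
  assumes "finite Q" "finite U" "Q \<inter> U = {}" "finite I"
    and I: "{(x, y). x \<in> Q \<union> U \<and> y \<in> U \<and> x \<noteq> y} \<subseteq> I" and p: "0 \<le> p" "p \<le> 1"
    and N: "N = card Q + card U"
  shows "map_pmf (\<lambda>\<omega>. card (reach Q U \<omega>)) (bernoulli_family I p) = reach_pmf p N (card Q)"
  using assms(1-5) N
proof (induction N arbitrary: Q U I)
  case 0
  then show ?case by (simp add: reach_def)
next
  case (Suc N)
  show ?case
  proof (cases "Q = {}")
    case True
    then show ?thesis by (simp add: reach_def)
  next
    case False
    then obtain x where x: "x \<in> Q" by auto
    let ?A = "Pair x ` U" and ?B = "I - Pair x ` U"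
    have "?A \<subseteq> I" using x Suc.prems by auto
    then have IAB: "I = ?A \<union> ?B" by auto
    have fin: "finite ?A" "finite ?B" "?A \<inter> ?B = {}" using Suc.prems by auto
    let ?J = "\<lambda>f. {y \<in> U. f (x, y)}"
    have "map_pmf (\<lambda>\<omega>. card (reach Q U \<omega>)) (bernoulli_family I p) =
      bind_pmf (bernoulli_family ?A p) (\<lambda>f. map_pmf (\<lambda>g. card (reach Q U (\<lambda>x. f x \<or> g x))) (bernoulli_family ?B p))"
      by (subst IAB, subst bernoulli_family_union[OF fin])
         (simp add: map_bind_pmf map_pmf_comp)
    also have "\<dots> = bind_pmf (bernoulli_family ?A p) (\<lambda>f. map_pmf Suc (reach_pmf p N (card Q - 1 + card (?J f))))"
    proof (intro bind_pmf_cong refl)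
      fix f assume f: "f \<in> set_pmf (bernoulli_family ?A p)"
      let ?Q = "Q - {x} \<union> ?J f" and ?U = "U - ?J f"
      have cQ: "card ?Q = card Q - 1 + card (?J f)"
        using Suc.prems x by (subst card_Un_disjoint) (auto simp: card_Diff_singleton)
      have cU: "card ?U = card U - card (?J f)" "card (?J f) \<le> card U"
        using Suc.prems by (auto intro: card_mono simp: card_Diff_subset)
      have "card Q > 0" using x Suc.prems by (auto simp: card_gt_0_iff)
      then have N: "N = card ?Q + card ?U" using cQ cU Suc.prems by simp
      have *: "card (reach Q U (\<lambda>x. f x \<or> g x)) = Suc (card (reach ?Q ?U g))"
        if g: "g \<in> set_pmf (bernoulli_family ?B p)" for g
      proof -
        have fA: "f e \<Longrightarrow> e \<in> ?A" for e using set_bernoulli_family[OF fin(1) f] .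
        have gB: "g e \<Longrightarrow> e \<in> ?B" for e using set_bernoulli_family[OF fin(2) g] .
        have J: "?J f = {y \<in> U. f (x, y) \<or> g (x, y)}" using gB by auto
        have x': "x \<notin> ?Q \<union> ?U" using x Suc.prems by auto
        have d: "?Q \<inter> ?U = {}" using Suc.prems by auto
        have "reach Q U (\<lambda>x. f x \<or> g x) = insert x (reach ?Q ?U (\<lambda>x. f x \<or> g x))"
          by (rule reach_step[OF x _ J]) (use Suc.prems in auto)
        also have "reach ?Q ?U (\<lambda>x. f x \<or> g x) = reach ?Q ?U g"
          unfolding reach_local[OF d, of "\<lambda>x. f x \<or> g x"] reach_local[OF d, of g]
          by (rule arg_cong[where f="reach ?Q ?U"], rule ext) (use fA x' in auto)
        finally have "reach Q U (\<lambda>x. f x \<or> g x) = insert x (reach ?Q ?U g)" .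
        moreover have "x \<notin> reach ?Q ?U g" "finite (reach ?Q ?U g)"
          using x' reach_subset[of ?Q ?U g] Suc.prems by (auto intro: finite_subset)
        ultimately show ?thesis by simp
      qed
      have "map_pmf (\<lambda>g. card (reach Q U (\<lambda>x. f x \<or> g x))) (bernoulli_family ?B p) =
         map_pmf Suc (map_pmf (\<lambda>g. card (reach ?Q ?U g)) (bernoulli_family ?B p))"
        unfolding map_pmf_comp using * by (intro map_pmf_cong) auto
      also have "map_pmf (\<lambda>g. card (reach ?Q ?U g)) (bernoulli_family ?B p) = reach_pmf p N (card ?Q)"
        by (intro Suc.IH N) (use Suc.prems x in auto)
      finally show "map_pmf (\<lambda>g. card (reach Q U (\<lambda>x. f x \<or> g x))) (bernoulli_family ?B p) =
         map_pmf Suc (reach_pmf p N (card Q - 1 + card (?J f)))" using cQ by simp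
    qed
    also have "\<dots> = bind_pmf (map_pmf (\<lambda>f. card {e \<in> ?A. f e}) (bernoulli_family ?A p))
        (\<lambda>j. map_pmf Suc (reach_pmf p N (card Q - 1 + j)))"
    proof -
      have "card (?J f) = card {e \<in> ?A. f e}" for f
        by (rule bij_betw_same_card[of "Pair x"]) (auto simp: bij_betw_def inj_on_def)
      then show ?thesis by (simp add: bind_map_pmf)
    qed
    also have "map_pmf (\<lambda>f. card {e \<in> ?A. f e}) (bernoulli_family ?A p) = binomial_pmf (card U) p"
      using p fin by (intro binomial_pmf_altdef'[symmetric]) (auto simp: card_image inj_on_def)
    also have "card U = Suc N - card Q" using Suc.prems by simp
    finally show ?thesis using False Suc.prems(1) by simp
  qed
qed

section \<open>Linear forests and strongly connected sets\<close>

text \<open>A linear forest spanning \<open>U\<close>, given by the vertex sequences of its directed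
  paths; isolated vertices are one-element lists.\<close>

definition path_partition :: "'a set \<Rightarrow> 'a list set \<Rightarrow> bool" where
  "path_partition U \<P> \<longleftrightarrow> finite \<P> \<and> [] \<notin> \<P> \<and> (\<forall>xs\<in>\<P>. distinct xs) \<and> (\<Union>xs\<in>\<P>. set xs) = U \<and>
     (\<forall>xs\<in>\<P>. \<forall>ys\<in>\<P>. xs \<noteq> ys \<longrightarrow> set xs \<inter> set ys = {})"

definition path_arcs :: "'a list \<Rightarrow> ('a \<times> 'a) set" where
  "path_arcs xs = set (zip xs (tl xs))"

lemma path_arcs_Nil [simp]: "path_arcs [] = {}"
  by (simp add: path_arcs_def)

lemma path_arcs_Cons: "path_arcs (x # xs) = (if xs = [] then {} else insert (x, hd xs) (path_arcs xs))"
  by (cases xs) (auto simp: path_arcs_def)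

lemma path_arcs_subset: "path_arcs xs \<subseteq> set xs \<times> set xs"
  by (induction xs) (auto simp: path_arcs_Cons)

lemma path_arcs_into: "y \<in> set xs \<Longrightarrow> y \<noteq> hd xs \<Longrightarrow> \<exists>x. (x, y) \<in> path_arcs xs"
  by (induction xs) (auto simp: path_arcs_Cons)

lemma path_arcs_out: "y \<in> set xs \<Longrightarrow> y \<noteq> last xs \<Longrightarrow> \<exists>z. (y, z) \<in> path_arcs xs"
  by (induction xs) (auto simp: path_arcs_Cons)

lemma last_notin_path_arcs: "distinct xs \<Longrightarrow> (last xs, y) \<notin> path_arcs xs"
  by (induction xs) (use path_arcs_subset in \<open>auto simp: path_arcs_Cons\<close>)

lemma hd_notin_path_arcs: "distinct xs \<Longrightarrow> xs \<noteq> [] \<Longrightarrow> (y, hd xs) \<notin> path_arcs xs"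
  by (cases xs) (use path_arcs_subset[of "tl xs"] in \<open>auto simp: path_arcs_Cons\<close>)

text \<open>A relation that is single-valued in both directions and along which \<open>d\<close>
  decreases has no cycles, hence consists of paths, and each arc lowers the number of paths by one.
  The induction removes a vertex \<open>u\<close> of largest \<open>d\<close>: nothing points to it,
  so it is isolated or can be prepended to a path.\<close>

lemma exists_path_partition:
  fixes d :: "'a \<Rightarrow> nat"
  assumes "finite U" and "F \<subseteq> U \<times> U" and "\<And>u w. (u, w) \<in> F \<Longrightarrow> d w < d u"
    and "\<And>u w w'. (u, w) \<in> F \<Longrightarrow> (u, w') \<in> F \<Longrightarrow> w = w'"
    and "\<And>u u' w. (u, w) \<in> F \<Longrightarrow> (u', w) \<in> F \<Longrightarrow> u = u'"
  shows "\<exists>\<P>. path_partition U \<P> \<and> (\<Union>xs\<in>\<P>. path_arcs xs) = F \<and> card F + card \<P> = card U"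
  using assms
proof (induction "card U" arbitrary: U F)
  case 0
  then have "U = {}" "F = {}" by auto
  then show ?case by (intro exI[of _ "{}"]) (auto simp: path_partition_def)
next
  case (Suc n)
  from Suc have "U \<noteq> {}" by auto
  then have "Max (d ` U) \<in> d ` U" using Suc by (intro Max_in) auto
  then obtain u where u: "u \<in> U" "d u = Max (d ` U)" by auto
  have umax: "d x \<le> d u" if "x \<in> U" for x using u that Suc by auto
  have noin: "(x, u) \<notin> F" for x using umax[of x] Suc.prems(2) Suc.prems(3)[of x u] by fastforce
  let ?U = "U - {u}" and ?F = "F \<inter> (U - {u}) \<times> (U - {u})"
  have "\<exists>\<P>. path_partition ?U \<P> \<and> (\<Union>xs\<in>\<P>. path_arcs xs) = ?F \<and> card ?F + card \<P> = card ?U"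
    by (rule Suc.hyps(1)) (use Suc u in \<open>auto simp: card_Diff_singleton\<close>)
  then obtain \<P> where P: "path_partition ?U \<P>" "(\<Union>xs\<in>\<P>. path_arcs xs) = ?F" "card ?F + card \<P> = card ?U" by auto
  have finF: "finite F" using Suc.prems(1,2) by (meson finite_SigmaI finite_subset)
  have cU: "card U = Suc (card ?U)" using u Suc by (simp add: card_Diff_singleton)
  show ?case
  proof (cases "\<exists>w. (u, w) \<in> F")
    case False
    then have F: "?F = F" using Suc.prems(2) noin by auto
    have "[u] \<notin> \<P>"
    proof
      assume "[u] \<in> \<P>"
      then have "u \<in> (\<Union>xs\<in>\<P>. set xs)" by force
      moreover have "(\<Union>xs\<in>\<P>. set xs) = U - {u}" using P(1) by (simp add: path_partition_def)
      ultimately show False by blast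
    qed
    show ?thesis
    proof (intro exI[of _ "insert [u] \<P>"] conjI)
      show "path_partition U (insert [u] \<P>)" using P(1) u by (auto simp: path_partition_def)
      show "(\<Union>xs\<in>insert [u] \<P>. path_arcs xs) = F" using P(2) F by (auto simp: path_arcs_Cons)
      show "card F + card (insert [u] \<P>) = card U"
        using P F cU \<open>[u] \<notin> \<P>\<close> by (simp add: path_partition_def)
    qed
  next
    case True
    then obtain w where w: "(u, w) \<in> F" by auto
    have wU: "w \<in> ?U" using w noin Suc.prems(2) by auto
    have UN: "(\<Union>xs\<in>\<P>. set xs) = ?U" using P(1) by (simp add: path_partition_def)
    then obtain xs where xs: "xs \<in> \<P>" "w \<in> set xs" using wU by blast
    have FF: "F = insert (u, w) ?F"
    proof -
      have "e \<in> insert (u, w) ?F" if "e \<in> F" for e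
        using that noin Suc.prems(2) Suc.prems(4)[OF w, of "snd e"] by (cases e) auto
      then show ?thesis using w by blast
    qed
    \<comment> \<open>The only predecessor of \<open>w\<close> is \<open>u\<close>, so
      \<open>w\<close> has none in the smaller forest and begins its path.\<close>
    have whd: "w = hd xs"
    proof (rule ccontr)
      assume "w \<noteq> hd xs"
      then obtain x where "(x, w) \<in> path_arcs xs" using path_arcs_into xs(2) by metis
      then have "(x, w) \<in> ?F" using P(2) xs(1) by auto
      then show False using Suc.prems(5)[OF w, of x] by blast
    qed
    have xsne: "xs \<noteq> []" using xs by auto
    let ?Q = "insert (u # xs) (\<P> - {xs})"
    have un: "u \<notin> set ys" if "ys \<in> \<P>" for ys using UN that by blast
    have nin: "u # xs \<notin> \<P>" using un[of "u # xs"] by auto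
    show ?thesis
    proof (intro exI[of _ ?Q] conjI)
      show "path_partition U ?Q"
        unfolding path_partition_def
      proof (intro conjI)
        show "finite ?Q" "[] \<notin> ?Q" "\<forall>xs\<in>?Q. distinct xs"
          using P(1) un[OF xs(1)] xs(1) unfolding path_partition_def by simp_all
        have "(\<Union>ys\<in>\<P>. set ys) = set xs \<union> (\<Union>ys\<in>\<P> - {xs}. set ys)" using xs(1) by blast
        then have "(\<Union>xs\<in>?Q. set xs) = insert u (\<Union>xs\<in>\<P>. set xs)" by simp
        then show "(\<Union>xs\<in>?Q. set xs) = U" unfolding UN insert_Diff[OF u(1)] .
        have dj: "set ys \<inter> set zs = {}" if "ys \<in> \<P>" "zs \<in> \<P>" "ys \<noteq> zs" for ys zs
          using P(1) that unfolding path_partition_def by blast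
        have "set (u # xs) \<inter> set ys = {}" if "ys \<in> \<P> - {xs}" for ys
          using dj[of xs ys] un[of ys] that xs(1) by auto
        then show "\<forall>xs\<in>?Q. \<forall>ys\<in>?Q. xs \<noteq> ys \<longrightarrow> set xs \<inter> set ys = {}"
          using dj by (metis Diff_iff Int_commute insert_iff)
      qed
      have "(\<Union>ys\<in>\<P>. path_arcs ys) = path_arcs xs \<union> (\<Union>ys\<in>\<P> - {xs}. path_arcs ys)" using xs(1) by blast
      then have "(\<Union>xs\<in>?Q. path_arcs xs) = insert (u, w) (\<Union>xs\<in>\<P>. path_arcs xs)"
        using whd xsne by (simp add: path_arcs_Cons)
      then show "(\<Union>xs\<in>?Q. path_arcs xs) = F" unfolding P(2) FF[symmetric] .
      have "card F = Suc (card ?F)"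
        using finF by (subst FF) (rule card_insert_disjoint, simp_all)
      moreover have "card ?Q = card \<P>"
      proof -
        have "finite \<P>" using P(1) by (simp add: path_partition_def)
        then show ?thesis using nin xs(1) card_Suc_Diff1[of \<P> xs] by simp
      qed
      ultimately show "card F + card ?Q = card U" using P(3) cU by simp
    qed
  qed
qed

section \<open>Counting linear forests\<close>

lemma card_compositions_le:
  assumes "0 < r" "r \<le> N"
  shows "finite {l :: nat list. length l = r \<and> sum_list l = N \<and> 0 \<notin> set l}"
    and "card {l :: nat list. length l = r \<and> sum_list l = N \<and> 0 \<notin> set l} \<le> (N - 1) choose (r - 1)"
proof -
  let ?A = "{l :: nat list. length l = r \<and> sum_list l = N \<and> 0 \<notin> set l}"
  let ?B = "{l :: nat list. length l = r \<and> sum_list l = N - r}"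
  \<comment> \<open>Subtracting 1 from each part gives a weak composition of \<open>N - r\<close>,
    to which stars and bars applies.\<close>
  have sub: "?A \<subseteq> map Suc ` ?B"
  proof
    fix l assume l: "l \<in> ?A"
    have "map Suc (map (\<lambda>x. x - 1) l) = l" using l by (auto simp: o_def intro!: map_idI) (metis Suc_pred gr0I)
    moreover have "sum_list (map (\<lambda>x. x - 1) l) = N - r"
    proof -
      have "0 \<notin> set l \<Longrightarrow> sum_list (map (\<lambda>x. x - 1) l) + length l = sum_list l" for l :: "nat list"
        by (induction l) auto
      from this[of l] l show ?thesis by simp
    qed
    ultimately show "l \<in> map Suc ` ?B" using l by (intro image_eqI[of _ _ "map (\<lambda>x. x - 1) l"]) auto
  qed
  have finB: "finite ?B"
    by (rule finite_subset[OF _ finite_lists_length_eq[of "{..N}" r]])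
       (use member_le_sum_list in fastforce)+
  show "finite ?A" using sub finB by (meson finite_imageI finite_subset)
  have "card ?A \<le> card ?B" using sub finB by (meson card_image_le card_mono finite_imageI order_trans)
  also have "\<dots> = (N - r + r - 1) choose (N - r)" by (rule card_length_sum_list)
  also have "\<dots> = (N - 1) choose (r - 1)"
    using assms binomial_symmetric[of "r - 1" "N - 1"] by simp
  finally show "card ?A \<le> (N - 1) choose (r - 1)" .
qed

text \<open>Concatenating the \<open>r\<close> paths in any of the \<open>r!\<close> orders yields a permutation of \<open>U\<close>
  together with a composition of \<open>|U|\<close>.\<close>

lemma card_path_partitions_le:
  assumes "finite U" "0 < r" "r \<le> card U"
  shows "finite {\<P>. path_partition U \<P> \<and> card \<P> = r}"
    and "card {\<P>. path_partition U \<P> \<and> card \<P> = r} * fact r \<le> fact (card U) * ((card U - 1) choose (r - 1))"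
proof -
  let ?A = "{\<P>. path_partition U \<P> \<and> card \<P> = r}"
  let ?C = "{l :: nat list. length l = r \<and> sum_list l = card U \<and> 0 \<notin> set l}"
  let ?B = "Sigma ?A permutations_of_set"
  \<comment> \<open>The concatenation forgets where the paths end; the list of lengths restores
    this, which makes the map injective.\<close>
  let ?h = "\<lambda>(\<P>, xss). (concat xss, map length xss)"
  have inj: "inj_on ?h ?B"
  proof (rule inj_onI)
    fix a b assume ab: "a \<in> ?B" "b \<in> ?B" "?h a = ?h b"
    have "snd a = snd b"
    proof (rule concat_injective)
      have m: "map length (snd a) = map length (snd b)" using ab(3) by (simp add: case_prod_beta)
      show "concat (snd a) = concat (snd b)" using ab(3) by (simp add: case_prod_beta)
      show "length (snd a) = length (snd b)" using m by (metis length_map)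
      have "length (snd a ! i) = length (snd b ! i)" if "i < length (snd a)" for i
        using m that by (metis \<open>length (snd a) = length (snd b)\<close> nth_map)
      then show "\<forall>(x, y)\<in>set (zip (snd a) (snd b)). length x = length y"
        by (auto simp: set_zip)
    qed
    moreover have "fst a = set (snd a)" "fst b = set (snd b)"
      using ab(1,2) unfolding permutations_of_set_def by force+
    ultimately show "a = b" by (simp add: prod_eq_iff)
  qed
  have img: "?h ` ?B \<subseteq> permutations_of_set U \<times> ?C"
  proof
    fix y assume "y \<in> ?h ` ?B"
    then obtain a where a: "a \<in> ?B" "y = ?h a" by (rule imageE)
    define \<P> xss where "\<P> = fst a" and "xss = snd a"
    have "\<P> \<in> ?A" "xss \<in> permutations_of_set \<P>" "y = (concat xss, map length xss)"
      using a unfolding \<P>_def xss_def by (cases a; simp)+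
    then have y: "y = (concat xss, map length xss)" "path_partition U \<P>" "card \<P> = r" "set xss = \<P>" "distinct xss"
      unfolding permutations_of_set_def by simp_all
    have "distinct (concat xss)"
      using y(2,4,5) unfolding path_partition_def by (intro distinct_concat) blast+
    have "set (concat xss) = U"
      using y(2,4) by (simp add: path_partition_def)
    have "length xss = r" using distinct_card[OF y(5)] y(3,4) by simp
    moreover have "sum_list (map length xss) = card U"
      using \<open>distinct (concat xss)\<close> \<open>set (concat xss) = U\<close> distinct_card[of "concat xss"] by (simp add: length_concat)
    moreover have "0 \<notin> set (map length xss)" using y(2,4) by (auto simp: path_partition_def)
    ultimately show "y \<in> permutations_of_set U \<times> ?C"
      using y(1) \<open>distinct (concat xss)\<close> \<open>set (concat xss) = U\<close> by (simp add: permutations_of_set_def)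
  qed
  have finC: "finite (permutations_of_set U \<times> ?C)" using card_compositions_le(1)[OF assms(2,3)] by simp
  have finB: "finite ?B" using inj img finC by (meson finite_imageD finite_subset)
  have finP: "finite \<P>" if "\<P> \<in> ?A" for \<P>
    using that by (simp add: path_partition_def)
  have "?A \<subseteq> fst ` ?B"
  proof
    fix \<P> assume P: "\<P> \<in> ?A"
    then obtain xss where "xss \<in> permutations_of_set \<P>"
      using finP[OF P] by (metis finite_distinct_list permutations_of_setI)
    with P have "(\<P>, xss) \<in> ?B" by blast
    then show "\<P> \<in> fst ` ?B" by (metis fst_conv image_eqI)
  qed
  then show finA: "finite ?A" using finB by (meson finite_imageI finite_subset)
  have "card ?A * fact r = (\<Sum>\<P>\<in>?A. fact r)" by simp
  also have "\<dots> = (\<Sum>\<P>\<in>?A. card (permutations_of_set \<P>))"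
  proof (rule sum.cong[OF refl])
    fix \<P> assume P: "\<P> \<in> ?A"
    show "fact r = card (permutations_of_set \<P>)"
      unfolding card_permutations_of_set[OF finP[OF P]] using P by simp
  qed
  also have "\<dots> = card ?B" by (rule card_SigmaI[symmetric, OF finA]) simp
  also have "\<dots> \<le> card (permutations_of_set U \<times> ?C)"
    using inj img finC by (rule card_inj_on_le)
  also have "\<dots> \<le> fact (card U) * ((card U - 1) choose (r - 1))"
    unfolding card_cartesian_product card_permutations_of_set[OF assms(1)]
    using card_compositions_le(2)[OF assms(2,3)] by (rule mult_le_mono2)
  finally show "card ?A * fact r \<le> fact (card U) * ((card U - 1) choose (r - 1))" .
qed

text \<open>Union bound over the argument that is sent to \<open>v\<close>. Prescribing this value
  saves a factor \<open>card S / card P\<close> against the number of all maps; the saving is used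
  for both maps that attach the paths of a witness.\<close>

lemma card_PiE_hitting_le:
  assumes "finite P" "finite S" "v \<in> S"
  shows "finite {\<phi> \<in> P \<rightarrow>\<^sub>E S. v \<in> \<phi> ` P}"
    and "card {\<phi> \<in> P \<rightarrow>\<^sub>E S. v \<in> \<phi> ` P} \<le> card P * card S ^ (card P - 1)"
proof -
  show "finite {\<phi> \<in> P \<rightarrow>\<^sub>E S. v \<in> \<phi> ` P}" using assms by (simp add: finite_PiE)
  have "{\<phi> \<in> P \<rightarrow>\<^sub>E S. v \<in> \<phi> ` P} \<subseteq> (\<Union>x\<in>P. PiE P (\<lambda>y. if y = x then {v} else S))"
  proof
    fix \<phi> assume "\<phi> \<in> {\<phi> \<in> P \<rightarrow>\<^sub>E S. v \<in> \<phi> ` P}"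
    then obtain x where "x \<in> P" "\<phi> x = v" "\<phi> \<in> P \<rightarrow>\<^sub>E S" by auto
    then show "\<phi> \<in> (\<Union>x\<in>P. PiE P (\<lambda>y. if y = x then {v} else S))"
      by (auto simp: PiE_iff)
  qed
  then have "card {\<phi> \<in> P \<rightarrow>\<^sub>E S. v \<in> \<phi> ` P} \<le> card (\<Union>x\<in>P. PiE P (\<lambda>y. if y = x then {v} else S))"
    using assms by (intro card_mono finite_UN_I finite_PiE) auto
  also have "\<dots> \<le> (\<Sum>x\<in>P. card (PiE P (\<lambda>y. if y = x then {v} else S)))"
    using assms by (intro card_UN_le) auto
  also have "\<dots> = (\<Sum>x\<in>P. card S ^ (card P - 1))"
  proof (intro sum.cong refl)
    fix x assume x: "x \<in> P"
    have "card (PiE P (\<lambda>y. if y = x then {v} else S)) = (\<Prod>y\<in>P. card (if y = x then {v} else S))"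
      using assms by (simp add: card_PiE)
    also have "\<dots> = (\<Prod>y\<in>P - {x}. card S)"
      using x assms by (subst prod.remove[of _ x]) (auto intro!: prod.cong)
    also have "\<dots> = card S ^ (card P - 1)" using x assms by (simp add: card_Diff_singleton)
    finally show "card (PiE P (\<lambda>y. if y = x then {v} else S)) = card S ^ (card P - 1)" .
  qed
  finally show "card {\<phi> \<in> P \<rightarrow>\<^sub>E S. v \<in> \<phi> ` P} \<le> card P * card S ^ (card P - 1)" by simp
qed

section \<open>Witnesses of strong connectivity\<close>

definition strong :: "('a \<times> 'a \<Rightarrow> bool) \<Rightarrow> 'a set \<Rightarrow> bool" where
  "strong \<omega> S \<longleftrightarrow> (\<forall>u\<in>S. \<forall>v\<in>S. (u, v) \<in> (Collect \<omega> \<inter> S \<times> S)\<^sup>*)"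

text \<open>Maximality is not part of \<open>strong\<close>, so further arcs cannot destroy it. This
  makes the existence of a large strong set monotone in the arc probability.\<close>

lemma strong_mono:
  assumes "strong \<omega> S" "\<And>e. \<omega> e \<Longrightarrow> \<omega>' e"
  shows "strong \<omega>' S"
proof -
  have "(Collect \<omega> \<inter> S \<times> S)\<^sup>* \<subseteq> (Collect \<omega>' \<inter> S \<times> S)\<^sup>*"
    using assms(2) by (intro rtrancl_mono) blast
  then show ?thesis using assms(1) unfolding strong_def by blast
qed

text \<open>Take for \<open>d\<close> the distance to \<open>v\<close> and let \<open>f\<close> move
  along a shortest path. Then \<open>f\<close> describes an in-tree with root \<open>v\<close>; for
  the converse relation it describes an out-tree.\<close>

lemma exists_descending_successor:
  fixes R :: "('a \<times> 'a) set"
  assumes "\<And>u. u \<in> S \<Longrightarrow> (u, v) \<in> R\<^sup>*"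
  shows "\<exists>f (d :: 'a \<Rightarrow> nat). \<forall>u. u \<in> S \<longrightarrow> u \<noteq> v \<longrightarrow> (u, f u) \<in> R \<and> d (f u) < d u"
proof -
  define d where "d u = (LEAST k. (u, v) \<in> R ^^ k)" for u
  have "\<exists>w. (u, w) \<in> R \<and> d w < d u" if u: "u \<in> S" "u \<noteq> v" for u
  proof -
    have "\<exists>k. (u, v) \<in> R ^^ k" using assms[OF u(1)] by (simp add: rtrancl_power)
    then have du: "(u, v) \<in> R ^^ d u" unfolding d_def by (rule LeastI_ex)
    with u(2) obtain k where k: "d u = Suc k" by (cases "d u") auto
    with du obtain w where w: "(u, w) \<in> R" "(w, v) \<in> R ^^ k" by (metis relpow_Suc_E2)
    have "d w \<le> k" unfolding d_def using w(2) by (rule Least_le)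
    then show ?thesis using w k by auto
  qed
  then have "\<forall>u. \<exists>w. u \<in> S \<longrightarrow> u \<noteq> v \<longrightarrow> (u, w) \<in> R \<and> d w < d u" by blast
  then obtain f where "\<forall>u. u \<in> S \<longrightarrow> u \<noteq> v \<longrightarrow> (u, f u) \<in> R \<and> d (f u) < d u" by (rule choice[THEN exE])
  then show ?thesis by blast
qed

lemma obtain_minimal_element:
  fixes d :: "'a \<Rightarrow> nat"
  assumes "U \<noteq> {}" obtains u where "u \<in> U" "\<And>x. x \<in> U \<Longrightarrow> d u \<le> d x"
  using ex_has_least_nat[of "\<lambda>x. x \<in> U"] assms by (metis equals0I)

text \<open>An in-tree and an out-tree with the common root \<open>v\<close> span \<open>S\<close>. The arcs that they share
  form a linear forest; each of its paths is left through one further arc of the in-tree and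
  entered through one further arc of the out-tree, and both kinds of arcs occur at \<open>v\<close>.\<close>

lemma strong_witness:
  assumes S: "strong \<omega> S" "finite S" "v \<in> S" and ne: "S - {v} \<noteq> {}"
  shows "\<exists>\<P> \<phi> \<gamma>. path_partition (S - {v}) \<P> \<and>
    \<phi> \<in> \<P> \<rightarrow>\<^sub>E S \<and> v \<in> \<phi> ` \<P> \<and> \<gamma> \<in> \<P> \<rightarrow>\<^sub>E S \<and> v \<in> \<gamma> ` \<P> \<and>
    (\<forall>e\<in>(\<Union>xs\<in>\<P>. path_arcs xs \<union> {(last xs, \<phi> xs), (\<gamma> xs, hd xs)}). \<omega> e) \<and>
    card (\<Union>xs\<in>\<P>. path_arcs xs \<union> {(last xs, \<phi> xs), (\<gamma> xs, hd xs)}) = card (S - {v}) + card \<P>"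
proof -
  let ?R = "Collect \<omega> \<inter> S \<times> S" and ?U = "S - {v}"
  have R: "(u, v) \<in> ?R\<^sup>*" if "u \<in> S" for u
    using S that by (simp add: strong_def)
  obtain f and d :: "'a \<Rightarrow> nat" where f: "\<And>u. u \<in> S \<Longrightarrow> u \<noteq> v \<Longrightarrow> (u, f u) \<in> ?R \<and> d (f u) < d u"
    using exists_descending_successor[OF R] by blast
  have R': "(u, v) \<in> (?R\<inverse>)\<^sup>*" if "u \<in> S" for u
    using S that by (simp add: strong_def rtrancl_converse)
  obtain g and d' :: "'a \<Rightarrow> nat" where g: "\<And>u. u \<in> S \<Longrightarrow> u \<noteq> v \<Longrightarrow> (u, g u) \<in> ?R\<inverse> \<and> d' (g u) < d' u"
    using exists_descending_successor[OF R'] by blast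
  \<comment> \<open>The in-tree has the arcs from \<open>u\<close> to \<open>f u\<close>, the
    out-tree those from \<open>g w\<close> to \<open>w\<close>; \<open>F\<close> consists of the
    common arcs that avoid \<open>v\<close>.\<close>
  define F where "F = {(u, w). u \<in> ?U \<and> w \<in> ?U \<and> f u = w \<and> g w = u}"
  have "\<exists>\<P>. path_partition ?U \<P> \<and> (\<Union>xs\<in>\<P>. path_arcs xs) = F \<and> card F + card \<P> = card ?U"
  proof (rule exists_path_partition)
    show "d w < d u" if "(u, w) \<in> F" for u w using that f[of u] by (auto simp: F_def)
  qed (use S(2) in \<open>auto simp: F_def\<close>)
  then obtain \<P> where P: "path_partition ?U \<P>" "(\<Union>xs\<in>\<P>. path_arcs xs) = F" "card F + card \<P> = card ?U"
    by (elim exE conjE)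
  have finP: "finite \<P>" and nP: "[] \<notin> \<P>" and UP: "(\<Union>xs\<in>\<P>. set xs) = ?U"
    using P(1) by (auto simp: path_partition_def)
  have dist: "distinct xs" if "xs \<in> \<P>" for xs using P(1) that by (simp add: path_partition_def)
  have dj: "xs = ys" if "xs \<in> \<P>" "ys \<in> \<P>" "x \<in> set xs" "x \<in> set ys" for xs ys x
    using P(1) that unfolding path_partition_def by blast
  have lastU: "last xs \<in> ?U" "last xs \<in> set xs" if "xs \<in> \<P>" for xs
    using UP that nP last_in_set[of xs] by blast+
  have hdU: "hd xs \<in> ?U" "hd xs \<in> set xs" if "xs \<in> \<P>" for xs
    using UP that nP hd_in_set[of xs] by blast+
  define \<phi> where "\<phi> = restrict (\<lambda>xs. f (last xs)) \<P>"
  define \<gamma> where "\<gamma> = restrict (\<lambda>xs. g (hd xs)) \<P>"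
  let ?L = "(\<lambda>xs. (last xs, f (last xs))) ` \<P>" and ?G = "(\<lambda>xs. (g (hd xs), hd xs)) ` \<P>"
  have W: "(\<Union>xs\<in>\<P>. path_arcs xs \<union> {(last xs, \<phi> xs), (\<gamma> xs, hd xs)}) = F \<union> ?L \<union> ?G"
    unfolding P(2)[symmetric] \<phi>_def \<gamma>_def by auto
  have lastF: "(last xs, y) \<notin> F" if "xs \<in> \<P>" for xs y
  proof
    assume "(last xs, y) \<in> F"
    then obtain ys where ys: "ys \<in> \<P>" "(last xs, y) \<in> path_arcs ys" using P(2) by blast
    then have "xs = ys" using dj[OF that ys(1)] lastU(2)[OF that] path_arcs_subset by fastforce
    then show False using last_notin_path_arcs[OF dist[OF that]] ys by blast
  qed
  have hdF: "(y, hd xs) \<notin> F" if "xs \<in> \<P>" for xs y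
  proof
    assume "(y, hd xs) \<in> F"
    then obtain ys where ys: "ys \<in> \<P>" "(y, hd xs) \<in> path_arcs ys" using P(2) by blast
    then have "xs = ys" using dj[OF that ys(1)] hdU(2)[OF that] path_arcs_subset by fastforce
    moreover have "xs \<noteq> []" using that nP by auto
    ultimately show False using hd_notin_path_arcs[OF dist[OF that]] ys by blast
  qed
  \<comment> \<open>An arc of both kinds would lie in both trees and avoid \<open>v\<close>, hence
    belong to \<open>F\<close>; but no arc of \<open>F\<close> leaves the end of a path.\<close>
  have "?L \<inter> ?G = {}"
  proof (rule ccontr)
    assume "?L \<inter> ?G \<noteq> {}"
    then obtain xs ys where "xs \<in> \<P>" "ys \<in> \<P>" "last xs = g (hd ys)" "f (last xs) = hd ys" by auto
    then have "(last xs, hd ys) \<in> F" using lastU(1)[of xs] hdU(1)[of ys] by (auto simp: F_def)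
    then show False using lastF \<open>xs \<in> \<P>\<close> by blast
  qed
  moreover have "card ?L = card \<P>"
    using dj lastU(2) by (intro card_image inj_onI) (metis prod.inject)
  moreover have "card ?G = card \<P>"
    using dj hdU(2) by (intro card_image inj_onI) (metis prod.inject)
  moreover have "F \<inter> (?L \<union> ?G) = {}" using lastF hdF by auto
  moreover have "finite F" using S(2) by (rule_tac finite_subset[of _ "S \<times> S"]) (auto simp: F_def)
  \<comment> \<open>The three parts are disjoint and have \<open>card F + 2 * card \<P>\<close>
    arcs, where \<open>card F + card \<P> = card ?U\<close>.\<close>
  ultimately have cW: "card (F \<union> ?L \<union> ?G) = card ?U + card \<P>"
    using finP P(3) by (simp add: card_Un_disjoint Un_assoc)
  have SP: "\<phi> \<in> \<P> \<rightarrow>\<^sub>E S" "\<gamma> \<in> \<P> \<rightarrow>\<^sub>E S"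
    unfolding \<phi>_def \<gamma>_def using f g lastU(1) hdU(1) by (auto simp: PiE_iff)
  have "v \<in> \<phi> ` \<P>"
  proof -
    \<comment> \<open>A vertex of \<open>?U\<close> with least \<open>d\<close> can only be sent to
      \<open>v\<close> by \<open>f\<close>. Its in-tree arc is therefore not in \<open>F\<close>,
      and it ends its path.\<close>
    obtain u where u: "u \<in> ?U" "\<And>x. x \<in> ?U \<Longrightarrow> d u \<le> d x" using obtain_minimal_element[OF ne] by metis
    then have fu: "f u = v" using f[of u] by (metis DiffE DiffI IntE SigmaE2 insertCI not_le singletonD)
    obtain xs where xs: "xs \<in> \<P>" "u \<in> set xs" using UP u(1) by blast
    have "u = last xs"
    proof (rule ccontr)
      assume "u \<noteq> last xs"
      then obtain z where "(u, z) \<in> path_arcs xs" using path_arcs_out xs(2) by metis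
      then have "(u, z) \<in> F" using P(2) xs(1) by blast
      then show False using fu by (auto simp: F_def)
    qed
    then show ?thesis using xs(1) fu unfolding \<phi>_def by force
  qed
  moreover have "v \<in> \<gamma> ` \<P>"
  proof -
    obtain u where u: "u \<in> ?U" "\<And>x. x \<in> ?U \<Longrightarrow> d' u \<le> d' x" using obtain_minimal_element[OF ne] by metis
    then have gu: "g u = v" using g[of u] by (metis DiffE DiffI IntE SigmaE2 converseD insertCI not_le singletonD)
    obtain xs where xs: "xs \<in> \<P>" "u \<in> set xs" using UP u(1) by blast
    have "u = hd xs"
    proof (rule ccontr)
      assume "u \<noteq> hd xs"
      then obtain z where "(z, u) \<in> path_arcs xs" using path_arcs_into xs(2) by metis
      then have "(z, u) \<in> F" using P(2) xs(1) by blast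
      then show False using gu by (auto simp: F_def)
    qed
    then show ?thesis using xs(1) gu unfolding \<gamma>_def by force
  qed
  moreover have "\<omega> e" if "e \<in> F \<union> ?L \<union> ?G" for e
    using that f g lastU(1) hdU(1) by (auto simp: F_def)
  ultimately show ?thesis
    using P(1) SP cW by (intro exI[of _ \<P>] exI[of _ \<phi>] exI[of _ \<gamma>]) (simp only: W, simp)
qed

text \<open>Union bound over the witnesses of \<open>strong_witness\<close>, sorted by the number
  \<open>r\<close> of paths. The first factors bound the number of linear forests on
  \<open>S\<close> without its root, the square bounds the choices of the two attaching maps, and a
  witness has \<open>l - 1 + r\<close> arcs.\<close>

lemma prob_strong_le:
  fixes S :: "'a set"
  assumes I: "finite I" and S: "finite S" "card S = l" "2 \<le> l" and p: "0 \<le> p" "p \<le> 1"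
  shows "measure_pmf.prob (bernoulli_family I p) {\<omega>. strong \<omega> S} \<le>
    (\<Sum>r=1..l-1. fact (l - 1) * real ((l - 2) choose (r - 1)) / fact r * (real r * real l ^ (r - 1))^2 * p ^ (l - 1 + r))"
proof -
  obtain v where v: "v \<in> S" using S by fastforce
  let ?U = "S - {v}"
  have cU: "card ?U = l - 1" "finite ?U" using S v by auto
  let ?V = "\<lambda>\<P> \<phi> \<gamma>. (\<Union>xs\<in>\<P>. path_arcs xs \<union> {(last xs, \<phi> xs), (\<gamma> xs, hd xs)})"
  define W :: "'a list set \<times> ('a list \<Rightarrow> 'a) \<times> ('a list \<Rightarrow> 'a) \<Rightarrow> ('a \<times> 'a) set" where "W = (\<lambda>(\<P>, \<phi>, \<gamma>). ?V \<P> \<phi> \<gamma>)"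
  let ?H = "\<lambda>\<P>. {\<phi> \<in> \<P> \<rightarrow>\<^sub>E S. v \<in> \<phi> ` \<P>}"
  let ?A = "\<lambda>r. {\<P>. path_partition ?U \<P> \<and> card \<P> = r}"
  define T where "T r = {t \<in> (SIGMA \<P>:?A r. ?H \<P> \<times> ?H \<P>). W t \<subseteq> I \<and> card (W t) = l - 1 + r}" for r
  let ?M = "bernoulli_family I p"
  have finH: "finite (?H \<P>)" if "finite \<P>" for \<P> using card_PiE_hitting_le(1)[OF that S(1) v] .
  have finA: "finite (?A r)" "card (?A r) * fact r \<le> fact (l - 1) * ((l - 2) choose (r - 1))" if "r \<in> {1..l-1}" for r
  proof -
    have r: "0 < r" "r \<le> card ?U" "l - 2 = card ?U - 1" using that cU(1) by auto
    show "finite (?A r)" by (rule card_path_partitions_le(1)[OF cU(2) r(1,2)])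
    show "card (?A r) * fact r \<le> fact (l - 1) * ((l - 2) choose (r - 1))"
      unfolding r(3) cU(1)[symmetric] by (rule card_path_partitions_le(2)[OF cU(2) r(1,2)])
  qed
  have fP: "finite \<P>" if "\<P> \<in> ?A r" for \<P> r using that by (simp add: path_partition_def)
  have finS: "finite (SIGMA \<P>:?A r. ?H \<P> \<times> ?H \<P>)" if "r \<in> {1..l-1}" for r
    by (intro finite_SigmaI finA(1)[OF that] finite_cartesian_product finH) (erule fP)+
  have cover: "\<exists>r\<in>{1..l-1}. \<exists>t\<in>T r. \<forall>e\<in>W t. \<omega> e"
    if \<omega>: "\<omega> \<in> set_pmf ?M" "strong \<omega> S" for \<omega>
  proof -
    have "card ?U > 0" using cU(1) S(3) by linarith
    then have ne: "?U \<noteq> {}" by (metis card.empty less_irrefl)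
    obtain \<P> \<phi> \<gamma> where w: "path_partition ?U \<P>" "\<phi> \<in> \<P> \<rightarrow>\<^sub>E S" "v \<in> \<phi> ` \<P>" "\<gamma> \<in> \<P> \<rightarrow>\<^sub>E S" "v \<in> \<gamma> ` \<P>"
      "\<forall>e\<in>?V \<P> \<phi> \<gamma>. \<omega> e" "card (?V \<P> \<phi> \<gamma>) = card ?U + card \<P>"
      using strong_witness[OF \<omega>(2) S(1) v ne] by (elim exE conjE)
    have "finite \<P>" using w(1) by (simp add: path_partition_def)
    moreover have "\<P> \<noteq> {}" using w(3) by auto
    ultimately have "1 \<le> card \<P>" by (simp add: Suc_le_eq card_gt_0_iff)
    moreover have "card \<P> \<le> l - 1"
    proof -
      have d: "\<And>xs ys. xs \<in> \<P> \<Longrightarrow> ys \<in> \<P> \<Longrightarrow> xs \<noteq> ys \<Longrightarrow> set xs \<inter> set ys = {}" and n: "[] \<notin> \<P>" and UN: "(\<Union>xs\<in>\<P>. set xs) = ?U"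
        using w(1) by (simp_all add: path_partition_def)
      have hd: "hd xs \<in> set xs" if "xs \<in> \<P>" for xs using n that by (metis hd_in_set)
      have "inj_on hd \<P>" by (rule inj_onI) (metis d hd disjoint_iff)
      moreover have "hd ` \<P> \<subseteq> ?U" using hd UN by blast
      ultimately show ?thesis using card_inj_on_le[of hd \<P> ?U] cU by simp
    qed
    moreover have "?V \<P> \<phi> \<gamma> \<subseteq> I"
    proof
      fix e assume "e \<in> ?V \<P> \<phi> \<gamma>"
      then have "\<omega> e" by (rule bspec[OF w(6)])
      then show "e \<in> I" by (rule set_bernoulli_family[OF I \<omega>(1)])
    qed
    moreover have "\<P> \<in> ?A (card \<P>)" "\<phi> \<in> ?H \<P>" "\<gamma> \<in> ?H \<P>"
      using w(1-5) by simp_all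
    ultimately have "card \<P> \<in> {1..l - 1}" "(\<P>, \<phi>, \<gamma>) \<in> T (card \<P>)"
      using w(7) cU(1) unfolding T_def W_def by simp_all
    moreover have "\<forall>e\<in>W (\<P>, \<phi>, \<gamma>). \<omega> e" unfolding W_def split by (rule w(6))
    ultimately show ?thesis by (rule_tac bexI[of _ "card \<P>"], rule_tac bexI[of _ "(\<P>, \<phi>, \<gamma>)"])
  qed
  have "measure_pmf.prob ?M {\<omega>. strong \<omega> S} = measure_pmf.prob ?M ({\<omega>. strong \<omega> S} \<inter> set_pmf ?M)"
    by (simp add: measure_Int_set_pmf)
  also have "\<dots> \<le> measure_pmf.prob ?M (\<Union>r\<in>{1..l-1}. \<Union>t\<in>T r. {\<omega>. \<forall>e\<in>W t. \<omega> e})"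
  proof (intro measure_pmf.finite_measure_mono subsetI)
    fix \<omega> assume "\<omega> \<in> {\<omega>. strong \<omega> S} \<inter> set_pmf ?M"
    then obtain r t where "r \<in> {1..l-1}" "t \<in> T r" "\<forall>e\<in>W t. \<omega> e"
      using cover[of \<omega>] by blast
    then show "\<omega> \<in> (\<Union>r\<in>{1..l-1}. \<Union>t\<in>T r. {\<omega>. \<forall>e\<in>W t. \<omega> e})" by blast
  qed simp
  also have "\<dots> \<le> (\<Sum>r=1..l-1. measure_pmf.prob ?M (\<Union>t\<in>T r. {\<omega>. \<forall>e\<in>W t. \<omega> e}))"
    by (intro measure_pmf.finite_measure_subadditive_finite) auto
  also have "\<dots> \<le> (\<Sum>r=1..l-1. \<Sum>t\<in>T r. measure_pmf.prob ?M {\<omega>. \<forall>e\<in>W t. \<omega> e})"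
  proof (rule sum_mono)
    fix r assume r: "r \<in> {1..l-1}"
    have "finite (T r)" using finS[OF r] unfolding T_def by simp
    then show "measure_pmf.prob ?M (\<Union>t\<in>T r. {\<omega>. \<forall>e\<in>W t. \<omega> e}) \<le> (\<Sum>t\<in>T r. measure_pmf.prob ?M {\<omega>. \<forall>e\<in>W t. \<omega> e})"
      by (intro measure_pmf.finite_measure_subadditive_finite) auto
  qed
  also have "\<dots> = (\<Sum>r=1..l-1. \<Sum>t\<in>T r. p ^ (l - 1 + r))"
  proof (intro sum.cong refl)
    fix r t assume "t \<in> T r"
    then have wI: "W t \<subseteq> I" and wc: "card (W t) = l - 1 + r" unfolding T_def by simp_all
    show "measure_pmf.prob ?M {\<omega>. \<forall>e\<in>W t. \<omega> e} = p ^ (l - 1 + r)"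
      unfolding prob_bernoulli_family_subset[OF I wI p] wc ..
  qed
  also have "\<dots> \<le> (\<Sum>r=1..l-1. fact (l - 1) * real ((l - 2) choose (r - 1)) / fact r * (real r * real l ^ (r - 1))^2 * p ^ (l - 1 + r))"
  proof (rule sum_mono)
    fix r assume r: "r \<in> {1..l-1}"
    have "card (T r) \<le> card (SIGMA \<P>:?A r. ?H \<P> \<times> ?H \<P>)"
      unfolding T_def using finS[OF r] by (intro card_mono Collect_restrict)
    also have "\<dots> = (\<Sum>\<P>\<in>?A r. card (?H \<P> \<times> ?H \<P>))"
      by (intro card_SigmaI finA(1)[OF r] ballI finite_cartesian_product finH) (erule fP)+
    also have "\<dots> \<le> (\<Sum>\<P>\<in>?A r. (r * l ^ (r - 1))^2)"
    proof (rule sum_mono)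
      fix \<P> assume P: "\<P> \<in> ?A r"
      then have "card (?H \<P>) \<le> r * l ^ (r - 1)"
        using card_PiE_hitting_le(2)[OF fP[OF P] S(1) v] S(2) by simp
      then show "card (?H \<P> \<times> ?H \<P>) \<le> (r * l ^ (r - 1))^2"
        by (simp add: card_cartesian_product power2_eq_square mult_le_mono)
    qed
    also have "\<dots> = card (?A r) * (r * l ^ (r - 1))^2" by simp
    finally have "real (card (T r)) \<le> real (card (?A r) * (r * l ^ (r - 1))^2)"
      by (simp only: of_nat_le_iff)
    also have "\<dots> = real (card (?A r)) * (real r * real l ^ (r - 1))^2"
      by (simp only: of_nat_mult of_nat_power)
    also have "\<dots> \<le> (fact (l - 1) * real ((l - 2) choose (r - 1)) / fact r) * (real r * real l ^ (r - 1))^2"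
    proof (rule mult_right_mono)
      have "real (card (?A r) * fact r) \<le> real (fact (l - 1) * ((l - 2) choose (r - 1)))"
        using finA(2)[OF r] by (simp only: of_nat_le_iff)
      then show "real (card (?A r)) \<le> fact (l - 1) * real ((l - 2) choose (r - 1)) / fact r"
        by (simp add: field_simps)
    qed simp
    finally have "real (card (T r)) * p ^ (l - 1 + r) \<le> (fact (l - 1) * real ((l - 2) choose (r - 1)) / fact r) * (real r * real l ^ (r - 1))^2 * p ^ (l - 1 + r)"
      using p by (intro mult_right_mono) auto
    then show "(\<Sum>t\<in>T r. p ^ (l - 1 + r)) \<le> fact (l - 1) * real ((l - 2) choose (r - 1)) / fact r * (real r * real l ^ (r - 1))^2 * p ^ (l - 1 + r)"
      by simp
  qed
  finally show ?thesis .
qed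

section \<open>Confined and unconfined strongly connected sets\<close>

lemma finite_possible_arcs [simp]: "finite (possible_arcs n)"
  by (rule finite_subset[of _ "{1..n} \<times> {1..n}"]) (auto simp: possible_arcs_def)

text \<open>A component is an induced subgraph, so its walks use only present arcs with both ends
  among its vertices. As \<open>1 \<le> n\<close>, the maximum is over a nonempty finite set and is
  attained.\<close>

lemma largest_scc_size_strong:
  assumes n: "1 \<le> n" and G: "G = \<lparr> pverts = {1..n}, parcs = {e \<in> possible_arcs n. \<omega> e} \<rparr>"
  shows "\<exists>S\<subseteq>{1..n}. card S = largest_scc_size G \<and> strong \<omega> S"
proof -
  let ?G = "with_proj G"
  have wf: "wf_digraph ?G"
    by unfold_locales (auto simp: G possible_arcs_def)
  let ?I = "(\<lambda>C. card (verts C)) ` pre_digraph.sccs ?G"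
  have sub: "induced_subgraph C ?G" "strongly_connected C" if "C \<in> pre_digraph.sccs ?G" for C
    using that unfolding pre_digraph.sccs_def by blast+
  have vC: "verts C \<subseteq> {1..n}" if "C \<in> pre_digraph.sccs ?G" for C
    using sub(1)[OF that] unfolding induced_subgraph_def subgraph_def by (simp add: G)
  have "?I \<subseteq> {..n}"
  proof
    fix k assume "k \<in> ?I"
    then obtain C where "C \<in> pre_digraph.sccs ?G" "k = card (verts C)" by blast
    then show "k \<in> {..n}" using card_mono[OF _ vC, of C] by simp
  qed
  then have fin: "finite ?I" using finite_subset by blast
  have "1 \<in> verts ?G" using n by (simp add: G)
  then have "pre_digraph.sccs_verts ?G \<noteq> {}"
    using wf_digraph.scc_of_in_sccs_verts[OF wf] by blast
  then have "pre_digraph.sccs ?G \<noteq> {}" using wf_digraph.sccs_verts_conv[OF wf] by auto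
  then have "Max ?I \<in> ?I" using fin by (intro Max_in) auto
  then obtain C where C: "C \<in> pre_digraph.sccs ?G" "card (verts C) = largest_scc_size G"
    unfolding largest_scc_size_def by auto
  have "arcs_ends C \<subseteq> Collect \<omega> \<inter> verts C \<times> verts C"
  proof -
    have "arcs C = {e \<in> parcs G. fst e \<in> verts C \<and> snd e \<in> verts C}" "tail C = fst" "head C = snd"
      using sub(1)[OF C(1)] unfolding induced_subgraph_def subgraph_def compatible_def by simp_all
    then show ?thesis by (auto simp: arcs_ends_def arc_to_ends_def G)
  qed
  then have "rtrancl_on (verts C) (arcs_ends C) \<subseteq> (Collect \<omega> \<inter> verts C \<times> verts C)\<^sup>*"
    using rtrancl_mono rtrancl_on_sub_rtrancl by blast
  then have "strong \<omega> (verts C)"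
    using sub(2)[OF C(1)] unfolding strong_def strongly_connected_def reachable_def by blast
  then show ?thesis using C vC by blast
qed

section \<open>Strongly connected sets and what they reach\<close>

lemma strong_local: "strong \<omega> S \<longleftrightarrow> strong (\<lambda>e. e \<in> S \<times> S \<and> \<omega> e) S"
proof -
  have "Collect \<omega> \<inter> S \<times> S = Collect (\<lambda>e. e \<in> S \<times> S \<and> \<omega> e) \<inter> S \<times> S" by blast
  then show ?thesis unfolding strong_def by (simp only:)
qed

lemma reach_superset: "Q \<subseteq> reach Q U \<omega>"
  by (auto simp: reach_def)

text \<open>Every vertex of \<open>S\<close> is reached from \<open>v\<close> inside
  \<open>S\<close>, and the set reached from \<open>v\<close> is closed under arcs into
  \<open>V\<close>: an arc into \<open>v\<close> itself adds nothing, as \<open>v\<close> is reached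
  from the start.\<close>

lemma strong_reach_subset:
  assumes "strong \<omega> S" "v \<in> S" "S \<subseteq> V"
  shows "reach S (V - S) \<omega> \<subseteq> reach {v} (V - {v}) \<omega>"
proof -
  let ?E = "{(x, y). \<omega> (x, y) \<and> y \<in> V - {v}}"
  have cl: "z \<in> reach {v} (V - {v}) \<omega>" if "y \<in> reach {v} (V - {v}) \<omega>" "\<omega> (y, z)" "z \<in> V" for y z
  proof (cases "z = v")
    case True
    then show ?thesis using reach_superset[of "{v}"] by blast
  next
    case False
    then have "(y, z) \<in> ?E" using that by simp
    then show ?thesis using that(1) unfolding reach_def by (auto intro: rtrancl_into_rtrancl)
  qed
  have S: "u \<in> reach {v} (V - {v}) \<omega>" if "(v, u) \<in> (Collect \<omega> \<inter> S \<times> S)\<^sup>*" for u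
    using that
  proof (induction rule: rtrancl_induct)
    case base
    then show ?case using reach_superset[of "{v}"] by blast
  next
    case (step y z)
    then show ?case using assms(3) by (intro cl[of y z]) auto
  qed
  have "z \<in> reach {v} (V - {v}) \<omega>" if "(u, z) \<in> {(x, y). \<omega> (x, y) \<and> y \<in> V - S}\<^sup>*" "u \<in> S" for u z
    using that
  proof (induction rule: rtrancl_induct)
    case base
    then show ?case using S assms(1,2) by (simp add: strong_def)
  next
    case (step y z)
    then show ?case by (intro cl[of y z]) auto
  qed
  then show ?thesis unfolding reach_def[of S] by auto
qed

lemma strong_in_arc:
  assumes "strong \<omega> S" "v \<in> S" "u \<in> S" "u \<noteq> v"
  shows "\<exists>x\<in>S - {v}. \<omega> (x, v)"
proof -
  let ?R = "Collect \<omega> \<inter> S \<times> S"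
  have "(u, v) \<in> ?R\<^sup>*" using assms by (simp add: strong_def)
  then have "u = v \<or> (\<exists>x\<in>S. x \<noteq> v \<and> \<omega> (x, v))"
  proof (induction rule: rtrancl_induct)
    case (step y z)
    then show ?case by (cases "y = z") auto
  qed simp
  then show ?thesis using assms(4) by blast
qed

section \<open>First moment bounds\<close>

lemma prob_ge_le_expectation:
  fixes X :: "'a \<Rightarrow> real"
  assumes "finite (set_pmf M)" "\<And>x. 0 \<le> X x" "0 < c"
  shows "measure_pmf.prob M {x. c \<le> X x} \<le> measure_pmf.expectation M X / c"
  using integral_Markov_inequality_measure[of M X "{}" c] assms
  by (simp add: integrable_measure_pmf_finite)

text \<open>The set reached from \<open>v\<close> is determined by arcs that do not end in
  \<open>v\<close>, hence independent of the arc from \<open>u\<close> to \<open>v\<close>. A union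
  bound over \<open>u\<close> leaves \<open>p\<close> times the expected number of reached
  \<open>u\<close> on the event that many vertices are reached.\<close>

lemma prob_return_arc_le:
  assumes p: "0 \<le> p" "p \<le> 1" and v: "v \<in> {1..n}"
  shows "measure_pmf.prob (bernoulli_family (possible_arcs n) p)
      {\<omega>. K < card (reach {v} ({1..n} - {v}) \<omega>) \<and> (\<exists>u\<in>{1..n} - {v}. \<omega> (u, v) \<and> u \<in> reach {v} ({1..n} - {v}) \<omega>)}
    \<le> p * measure_pmf.expectation (reach_pmf p n 1) (\<lambda>t. if K < t then real t else 0)"
proof -
  let ?V = "{1..n}" and ?M = "bernoulli_family (possible_arcs n) p"
  let ?R = "\<lambda>\<omega>. reach {v} (?V - {v}) \<omega>"
  note fM = finite_set_bernoulli_family[OF finite_possible_arcs]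
  have loc: "?R \<omega> = ?R (\<lambda>e. e \<in> {(x, y). y \<noteq> v} \<and> \<omega> e)" for \<omega>
  proof -
    have "{(x, y). \<omega> (x, y) \<and> y \<in> ?V - {v}} = {(x, y). ((x, y) \<in> {(x, y). y \<noteq> v} \<and> \<omega> (x, y)) \<and> y \<in> ?V - {v}}" by auto
    then show ?thesis unfolding reach_def by simp
  qed
  have "measure_pmf.prob ?M {\<omega>. K < card (?R \<omega>) \<and> (\<exists>u\<in>?V - {v}. \<omega> (u, v) \<and> u \<in> ?R \<omega>)}
    \<le> measure_pmf.prob ?M (\<Union>u\<in>?V - {v}. {\<omega>. \<omega> (u, v) \<and> u \<in> ?R \<omega> \<and> K < card (?R \<omega>)})"
    by (intro measure_pmf.finite_measure_mono) auto
  also have "\<dots> \<le> (\<Sum>u\<in>?V - {v}. measure_pmf.prob ?M {\<omega>. \<omega> (u, v) \<and> (u \<in> ?R \<omega> \<and> K < card (?R \<omega>))})"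
    by (intro measure_pmf.finite_measure_subadditive_finite) auto
  also have "\<dots> = (\<Sum>u\<in>?V - {v}. p * measure_pmf.prob ?M {\<omega>. u \<in> ?R \<omega> \<and> K < card (?R \<omega>)})"
  proof (rule sum.cong[OF refl])
    fix u assume u: "u \<in> ?V - {v}"
    have "measure_pmf.prob ?M {\<omega>. \<omega> (u, v) \<and> (u \<in> ?R \<omega> \<and> K < card (?R \<omega>))} =
      measure_pmf.prob ?M {\<omega>. \<omega> (u, v)} * measure_pmf.prob ?M {\<omega>. u \<in> ?R \<omega> \<and> K < card (?R \<omega>)}"
    proof (rule prob_bernoulli_family_indep[OF finite_possible_arcs, of "{(u, v)}" "{(x, y). y \<noteq> v}"])
      show "(u \<in> ?R \<omega> \<and> K < card (?R \<omega>)) \<longleftrightarrow>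
        (u \<in> ?R (\<lambda>e. e \<in> {(x, y). y \<noteq> v} \<and> \<omega> e) \<and> K < card (?R (\<lambda>e. e \<in> {(x, y). y \<noteq> v} \<and> \<omega> e)))" for \<omega>
        unfolding loc[of \<omega>, symmetric] ..
    qed auto
    also have "measure_pmf.prob ?M {\<omega>. \<omega> (u, v)} = p"
      using prob_bernoulli_family_subset[OF finite_possible_arcs _ p, of "{(u, v)}"] u v by (simp add: possible_arcs_def)
    finally show "measure_pmf.prob ?M {\<omega>. \<omega> (u, v) \<and> (u \<in> ?R \<omega> \<and> K < card (?R \<omega>))} =
      p * measure_pmf.prob ?M {\<omega>. u \<in> ?R \<omega> \<and> K < card (?R \<omega>)}" .
  qed
  also have "\<dots> = p * (\<Sum>u\<in>?V - {v}. measure_pmf.expectation ?M (indicator {\<omega>. u \<in> ?R \<omega> \<and> K < card (?R \<omega>)}))"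
    by (simp add: sum_distrib_left)
  also have "\<dots> = p * measure_pmf.expectation ?M (\<lambda>\<omega>. \<Sum>u\<in>?V - {v}. indicator {\<omega>. u \<in> ?R \<omega> \<and> K < card (?R \<omega>)} \<omega>)"
    by (subst Bochner_Integration.integral_sum) (auto intro: integrable_measure_pmf_finite fM)
  also have "\<dots> \<le> p * measure_pmf.expectation ?M (\<lambda>\<omega>. if K < card (?R \<omega>) then real (card (?R \<omega>)) else 0)"
  proof (intro mult_left_mono p integral_mono integrable_measure_pmf_finite fM)
    fix \<omega>
    have fR: "finite (?R \<omega>)" using reach_subset[of "{v}" "?V - {v}" \<omega>] by (rule finite_subset) simp
    have "(\<Sum>u\<in>?V - {v}. indicator {\<omega>. u \<in> ?R \<omega> \<and> K < card (?R \<omega>)} \<omega> :: real) =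
        (if K < card (?R \<omega>) then real (card ((?V - {v}) \<inter> ?R \<omega>)) else 0)"
      by (simp add: indicator_def of_bool_def sum.If_cases Int_def)
    also have "\<dots> \<le> (if K < card (?R \<omega>) then real (card (?R \<omega>)) else 0)"
      using fR by (auto intro: card_mono)
    finally show "(\<Sum>u\<in>?V - {v}. indicator {\<omega>. u \<in> ?R \<omega> \<and> K < card (?R \<omega>)} \<omega>) \<le> (if K < card (?R \<omega>) then real (card (?R \<omega>)) else 0)" .
  qed
  also have "measure_pmf.expectation ?M (\<lambda>\<omega>. if K < card (?R \<omega>) then real (card (?R \<omega>)) else 0)
     = measure_pmf.expectation (map_pmf (\<lambda>\<omega>. card (?R \<omega>)) ?M) (\<lambda>t. if K < t then real t else 0)"
    by (simp only: integral_map_pmf)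
  also have "map_pmf (\<lambda>\<omega>. card (?R \<omega>)) ?M = reach_pmf p n (card {v})"
    using v finite_possible_arcs p by (intro card_reach_distr) (auto simp: possible_arcs_def)
  finally show ?thesis by simp
qed

text \<open>Being strong depends on the arcs inside \<open>S\<close>, the set reached from
  \<open>S\<close> only on arcs that end outside \<open>S\<close>; so the two events are
  independent.\<close>

lemma prob_strong_confined:
  assumes p: "0 \<le> p" "p \<le> 1" and S: "S \<subseteq> {1..n}" "card S = l"
  shows "measure_pmf.prob (bernoulli_family (possible_arcs n) p)
      {\<omega>. strong \<omega> S \<and> card (reach S ({1..n} - S) \<omega>) \<le> K}
    = measure_pmf.prob (bernoulli_family (possible_arcs n) p) {\<omega>. strong \<omega> S}
      * measure_pmf.prob (reach_pmf p n l) {..K}"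
proof -
  let ?V = "{1..n}" and ?M = "bernoulli_family (possible_arcs n) p"
  let ?R = "\<lambda>\<omega>. reach S (?V - S) \<omega>"
  have fS: "finite S" using S(1) finite_subset by blast
  have loc: "?R \<omega> = ?R (\<lambda>e. e \<in> {(x, y). y \<notin> S} \<and> \<omega> e)" for \<omega>
  proof -
    have "{(x, y). \<omega> (x, y) \<and> y \<in> ?V - S} = {(x, y). ((x, y) \<in> {(x, y). y \<notin> S} \<and> \<omega> (x, y)) \<and> y \<in> ?V - S}" by auto
    then show ?thesis unfolding reach_def by simp
  qed
  have "measure_pmf.prob ?M {\<omega>. strong \<omega> S \<and> card (?R \<omega>) \<le> K} =
    measure_pmf.prob ?M {\<omega>. strong \<omega> S} * measure_pmf.prob ?M {\<omega>. card (?R \<omega>) \<le> K}"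
  proof (rule prob_bernoulli_family_indep[OF finite_possible_arcs, of "S \<times> S" "{(x, y). y \<notin> S}"])
    show "strong \<omega> S \<longleftrightarrow> strong (\<lambda>e. e \<in> S \<times> S \<and> \<omega> e) S" for \<omega> by (rule strong_local)
    show "(card (?R \<omega>) \<le> K) \<longleftrightarrow> (card (?R (\<lambda>e. e \<in> {(x, y). y \<notin> S} \<and> \<omega> e)) \<le> K)" for \<omega>
      unfolding loc[of \<omega>, symmetric] ..
  qed auto
  also have "measure_pmf.prob ?M {\<omega>. card (?R \<omega>) \<le> K} = measure_pmf.prob (map_pmf (\<lambda>\<omega>. card (?R \<omega>)) ?M) {..K}"
    by (simp add: measure_map_pmf vimage_def)
  also have "map_pmf (\<lambda>\<omega>. card (?R \<omega>)) ?M = reach_pmf p n (card S)"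
    using fS finite_possible_arcs p S card_mono[OF _ S(1)]
    by (intro card_reach_distr) (auto simp: possible_arcs_def card_Diff_subset)
  finally show ?thesis using S(2) by simp
qed

text \<open>Either a strong set \<open>S\<close> reaches more than \<open>K\<close> vertices, and then each of its at least \<open>m\<close>
  elements reaches more than \<open>K\<close> vertices and receives an arc from one of them, which Markov's
  inequality makes unlikely; or \<open>S\<close> is confined, which is bounded by the expected number of
  such sets.\<close>

lemma prob_exists_strong_le:
  assumes p: "0 \<le> p" "p \<le> 1" and m: "2 \<le> m"
    and B: "\<And>S l. S \<subseteq> {1..n} \<Longrightarrow> card S = l \<Longrightarrow> m \<le> l \<Longrightarrow>
       measure_pmf.prob (bernoulli_family (possible_arcs n) p) {\<omega>. strong \<omega> S} \<le> B l"
  shows "measure_pmf.prob (bernoulli_family (possible_arcs n) p) {\<omega>. \<exists>S\<subseteq>{1..n}. m \<le> card S \<and> strong \<omega> S}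
    \<le> real n * p * measure_pmf.expectation (reach_pmf p n 1) (\<lambda>t. if K < t then real t else 0) / real m
      + (\<Sum>l=m..n. real (n choose l) * B l * measure_pmf.prob (reach_pmf p n l) {..K})"
proof -
  let ?V = "{1..n}" and ?M = "bernoulli_family (possible_arcs n) p"
  note fM = finite_set_bernoulli_family[OF finite_possible_arcs]
  define b where "b v \<omega> \<longleftrightarrow> K < card (reach {v} (?V - {v}) \<omega>) \<and> (\<exists>u\<in>?V - {v}. \<omega> (u, v) \<and> u \<in> reach {v} (?V - {v}) \<omega>)" for v \<omega>
  define E1 where "E1 = {\<omega>. real m \<le> (\<Sum>v\<in>?V. indicator {\<omega>. b v \<omega>} \<omega>)}"
  define E2 where "E2 l S = {\<omega>. strong \<omega> S \<and> card (reach S (?V - S) \<omega>) \<le> K}" for l :: nat and S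
  have cover: "{\<omega>. \<exists>S\<subseteq>?V. m \<le> card S \<and> strong \<omega> S} \<subseteq> E1 \<union> (\<Union>l\<in>{m..n}. \<Union>S\<in>{S. S \<subseteq> ?V \<and> card S = l}. E2 l S)"
  proof
    fix \<omega> assume "\<omega> \<in> {\<omega>. \<exists>S\<subseteq>?V. m \<le> card S \<and> strong \<omega> S}"
    then obtain S where S: "S \<subseteq> ?V" "m \<le> card S" "strong \<omega> S" by blast
    have fS: "finite S" using S(1) finite_subset by blast
    have cS: "card S \<le> n" using card_mono[OF _ S(1)] by simp
    show "\<omega> \<in> E1 \<union> (\<Union>l\<in>{m..n}. \<Union>S\<in>{S. S \<subseteq> ?V \<and> card S = l}. E2 l S)"
    proof (cases "card (reach S (?V - S) \<omega>) \<le> K")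
      case True
      then have "\<omega> \<in> E2 (card S) S" using S by (simp add: E2_def)
      then show ?thesis using S cS by (intro UnI2 UN_I[of "card S"] UN_I[of S]) simp_all
    next
      case False
      have "b v \<omega>" if v: "v \<in> S" for v
      proof -
        let ?R = "reach {v} (?V - {v}) \<omega>"
        have sub: "reach S (?V - S) \<omega> \<subseteq> ?R" by (rule strong_reach_subset[OF S(3) v S(1)])
        have "?R \<subseteq> {v} \<union> (?V - {v})" by (rule reach_subset)
        then have fR: "finite ?R" by (rule finite_subset) simp
        have "K < card ?R" using card_mono[OF fR sub] False by simp
        \<comment> \<open>Here \<open>2 \<le> m\<close> provides a second element of
          \<open>S\<close>, and with it an arc into \<open>v\<close>.\<close>
        moreover have "card (S - {v}) > 0" using v fS S(2) m by (simp add: card_Diff_singleton)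
        then obtain u where "u \<in> S" "u \<noteq> v" by (auto simp: card_gt_0_iff)
        then obtain x where x: "x \<in> S - {v}" "\<omega> (x, v)" using strong_in_arc[OF S(3) v] by blast
        moreover have "x \<in> ?R" using x sub reach_superset[of S] by blast
        ultimately show ?thesis using S(1) unfolding b_def by blast
      qed
      then have "real m \<le> (\<Sum>v\<in>S. indicator {\<omega>. b v \<omega>} \<omega>)" using S(2) by simp
      also have "\<dots> \<le> (\<Sum>v\<in>?V. indicator {\<omega>. b v \<omega>} \<omega>)"
        using S(1) by (intro sum_mono2) auto
      finally show ?thesis by (simp add: E1_def)
    qed
  qed
  have "measure_pmf.prob ?M {\<omega>. \<exists>S\<subseteq>?V. m \<le> card S \<and> strong \<omega> S}
     \<le> measure_pmf.prob ?M (E1 \<union> (\<Union>l\<in>{m..n}. \<Union>S\<in>{S. S \<subseteq> ?V \<and> card S = l}. E2 l S))"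
    using cover by (intro measure_pmf.finite_measure_mono) auto
  also have "\<dots> \<le> measure_pmf.prob ?M E1 + measure_pmf.prob ?M (\<Union>l\<in>{m..n}. \<Union>S\<in>{S. S \<subseteq> ?V \<and> card S = l}. E2 l S)"
    by (intro measure_Un_le) auto
  also have "\<dots> \<le> real n * p * measure_pmf.expectation (reach_pmf p n 1) (\<lambda>t. if K < t then real t else 0) / real m
      + (\<Sum>l=m..n. real (n choose l) * B l * measure_pmf.prob (reach_pmf p n l) {..K})"
  proof (rule add_mono)
    let ?T = "measure_pmf.expectation (reach_pmf p n 1) (\<lambda>t. if K < t then real t else 0)"
    have "measure_pmf.prob ?M E1 \<le> measure_pmf.expectation ?M (\<lambda>\<omega>. \<Sum>v\<in>?V. indicator {\<omega>. b v \<omega>} \<omega>) / real m"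
      unfolding E1_def using m by (intro prob_ge_le_expectation fM sum_nonneg) auto
    also have "measure_pmf.expectation ?M (\<lambda>\<omega>. \<Sum>v\<in>?V. indicator {\<omega>. b v \<omega>} \<omega>) = (\<Sum>v\<in>?V. measure_pmf.prob ?M {\<omega>. b v \<omega>})"
      by (subst Bochner_Integration.integral_sum) (auto intro: integrable_measure_pmf_finite fM)
    also have "\<dots> \<le> (\<Sum>v\<in>?V. p * ?T)"
      unfolding b_def by (intro sum_mono prob_return_arc_le p)
    finally show "measure_pmf.prob ?M E1 \<le> real n * p * ?T / real m"
      using m by (simp add: divide_right_mono mult.assoc)
  next
    have "measure_pmf.prob ?M (\<Union>l\<in>{m..n}. \<Union>S\<in>{S. S \<subseteq> ?V \<and> card S = l}. E2 l S)
      \<le> (\<Sum>l=m..n. measure_pmf.prob ?M (\<Union>S\<in>{S. S \<subseteq> ?V \<and> card S = l}. E2 l S))"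
      by (intro measure_pmf.finite_measure_subadditive_finite) auto
    also have "\<dots> \<le> (\<Sum>l=m..n. \<Sum>S\<in>{S. S \<subseteq> ?V \<and> card S = l}. measure_pmf.prob ?M (E2 l S))"
      by (intro sum_mono measure_pmf.finite_measure_subadditive_finite) auto
    also have "\<dots> \<le> (\<Sum>l=m..n. \<Sum>S\<in>{S. S \<subseteq> ?V \<and> card S = l}. B l * measure_pmf.prob (reach_pmf p n l) {..K})"
    proof (intro sum_mono)
      fix l S assume l: "l \<in> {m..n}" and S: "S \<in> {S. S \<subseteq> ?V \<and> card S = l}"
      have "measure_pmf.prob ?M (E2 l S) = measure_pmf.prob ?M {\<omega>. strong \<omega> S} * measure_pmf.prob (reach_pmf p n l) {..K}"
        unfolding E2_def by (rule prob_strong_confined[OF p]) (use S in simp_all)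
      also have "\<dots> \<le> B l * measure_pmf.prob (reach_pmf p n l) {..K}"
        using B[of S l] S l by (intro mult_right_mono) auto
      finally show "measure_pmf.prob ?M (E2 l S) \<le> B l * measure_pmf.prob (reach_pmf p n l) {..K}" .
    qed
    also have "\<dots> = (\<Sum>l=m..n. real (n choose l) * B l * measure_pmf.prob (reach_pmf p n l) {..K})"
      by (simp add: n_subsets mult.assoc)
    finally show "measure_pmf.prob ?M (\<Union>l\<in>{m..n}. \<Union>S\<in>{S. S \<subseteq> ?V \<and> card S = l}. E2 l S)
      \<le> (\<Sum>l=m..n. real (n choose l) * B l * measure_pmf.prob (reach_pmf p n l) {..K})" .
  qed
  finally show ?thesis .
qed

section \<open>Estimates in the critical window\<close>

text \<open>For nonnegative terms the sum of squares is at most the square of the sum, here a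
  partial sum of the exponential series.\<close>

lemma sum_squared_exp_terms_le:
  fixes w :: real
  assumes "0 \<le> w"
  shows "(\<Sum>k<M. (w ^ k / fact k)^2) \<le> exp (2 * w)"
proof -
  have "(\<Sum>k<M. (w ^ k / fact k)^2) \<le> (\<Sum>k<M. w ^ k / fact k)^2"
  proof (induction M)
    case (Suc M)
    have "0 \<le> (\<Sum>k<M. w ^ k / fact k) * (w ^ M / fact M)" using assms by (intro mult_nonneg_nonneg sum_nonneg) auto
    then show ?case using Suc by (simp add: power2_sum)
  qed simp
  also have "\<dots> \<le> exp w ^ 2"
  proof (intro power_mono sum_nonneg)
    have "(\<Sum>k<M. w ^ k / fact k) \<le> (\<Sum>k. w ^ k / fact k)"
      using assms summable_exp[of w] by (intro sum_le_suminf) (auto simp: divide_inverse mult.commute)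
    then show "(\<Sum>k<M. w ^ k / fact k) \<le> exp w" by (simp add: exp_def divide_inverse scaleR_conv_of_real mult.commute)
  qed (use assms in auto)
  finally show ?thesis by (simp add: exp_double)
qed

text \<open>With r = k + 1 the factorials cancel: (n choose l) (l - 1)! <= n^l / l, r^2 / r! = (k +
  1) / k! <= 2^k / k! and ((l - 2) choose k) <= l^k / k!. The summand becomes (n p)^l / l times (2
  l^3 p)^k / (k!)^2, the square of a term of an exponential series.\<close>

lemma expected_strong_sets_le:
  fixes p :: real
  assumes p: "0 \<le> p" and l: "2 \<le> l"
  shows "real (n choose l) * (\<Sum>r=1..l-1. fact (l - 1) * real ((l - 2) choose (r - 1)) / fact r * (real r * real l ^ (r - 1))^2 * p ^ (l - 1 + r))
    \<le> (real n * p) ^ l / real l * exp (2 * sqrt (2 * real l ^ 3 * p))"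
proof -
  let ?w = "sqrt (2 * real l ^ 3 * p)"
  let ?t = "\<lambda>r. fact (l - 1) * real ((l - 2) choose (r - 1)) / fact r * (real r * real l ^ (r - 1))^2 * p ^ (l - 1 + r)"
  have w2: "?w^2 = 2 * real l ^ 3 * p" using p by simp
  have fl: "fact l = real l * (fact (l - 1) :: real)" using l by (simp add: fact_reduce)
  have nl: "real (n choose l) \<le> real n ^ l / fact l"
  proof -
    have "real ((n choose l) * fact l) \<le> real (n ^ l)" using binomial_fact_pow[of n l] by (simp only: of_nat_le_iff)
    then show ?thesis by (simp add: field_simps)
  qed
  have t: "real (n choose l) * ?t (Suc k) \<le> (real n * p) ^ l / real l * (?w ^ k / fact k)^2" if k: "k < l - 1" for k
  proof -
    have b: "real ((l - 2) choose k) \<le> real l ^ k / fact k"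
    proof -
      have "((l - 2) choose k) * fact k \<le> l ^ k"
        using binomial_fact_pow[of "l - 2" k] power_mono[of "l - 2" l k] by simp
      then have "real (((l - 2) choose k) * fact k) \<le> real (l ^ k)" by (simp only: of_nat_le_iff)
      then show ?thesis by (simp add: field_simps)
    qed
    have "real (Suc k) \<le> real (2 ^ k)" using less_exp[of k] by (simp only: of_nat_le_iff Suc_le_eq)
    then have b2: "real (Suc k) \<le> 2 ^ k" by simp
    have "real (n choose l) * ?t (Suc k) \<le> (real n ^ l / fact l) * ?t (Suc k)"
      using nl p by (intro mult_right_mono) auto
    also have "\<dots> = (real n * p) ^ l / real l * (real ((l - 2) choose k) * (real (Suc k) / fact k) * (real l ^ 2 * p) ^ k)"
    proof -
      have e: "l - 1 + Suc k = l + k" using l by simp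
      have f: "fact (Suc k) = real (Suc k) * (fact k :: real)" by simp
      show ?thesis unfolding e f fl using l
        by (simp add: field_simps power_add power_mult_distrib power2_eq_square power_mult[symmetric] del: of_nat_Suc fact_Suc)
    qed
    also have "\<dots> \<le> (real n * p) ^ l / real l * ((real l ^ k / fact k) * (2 ^ k / fact k) * (real l ^ 2 * p) ^ k)"
      using b b2 p by (intro mult_left_mono mult_right_mono mult_mono divide_right_mono) auto
    also have "(real l ^ k / fact k) * (2 ^ k / fact k) * (real l ^ 2 * p) ^ k = (?w ^ k / fact k)^2"
    proof -
      have "(?w ^ k / fact k)^2 = (?w^2) ^ k / (fact k)^2" by (simp add: power_divide power_mult[symmetric] mult.commute)
      also have "\<dots> = (2 * real l ^ 3 * p) ^ k / (fact k)^2" unfolding w2 ..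
      also have "\<dots> = (real l * 2 * (real l ^ 2 * p)) ^ k / (fact k)^2"
        by (rule arg_cong[where f="\<lambda>z. z ^ k / (fact k)^2"]) (simp add: power2_eq_square power3_eq_cube)
      finally have e: "(?w ^ k / fact k)^2 = (real l * 2 * (real l ^ 2 * p)) ^ k / (fact k)^2" .
      show ?thesis unfolding e by (simp add: power_mult_distrib power2_eq_square)
    qed
    finally show ?thesis .
  qed
  have "real (n choose l) * (\<Sum>r=1..l-1. ?t r) = (\<Sum>k<l-1. real (n choose l) * ?t (Suc k))"
    unfolding sum_distrib_left One_nat_def by (rule sum.atLeast1_atMost_eq)
  also have "\<dots> \<le> (\<Sum>k<l-1. (real n * p) ^ l / real l * (?w ^ k / fact k)^2)"
    using t by (intro sum_mono) simp
  also have "\<dots> = (real n * p) ^ l / real l * (\<Sum>k<l-1. (?w ^ k / fact k)^2)"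
    by (simp only: sum_distrib_left)
  also have "\<dots> \<le> (real n * p) ^ l / real l * exp (2 * ?w)"
    using p by (intro mult_left_mono sum_squared_exp_terms_le) auto
  finally show ?thesis .
qed

text \<open>In \<open>prob_reach_pmf_atMost_le\<close> the choice \<theta> = l / (2 K) makes the
  main part - \<theta> l + \<theta>^2 K / 2 of the exponent equal to - 3 l^2 / (8 K). The loss of up
  to K unseen vertices costs l K / (2 n), which 4 K^2 <= l n bounds by l^2 / (8 K).\<close>

lemma prob_reach_small_le:
  assumes p: "0 \<le> p" "p \<le> 1" "1 \<le> real n * p" and K: "0 < K" "K \<le> n" "4 * real K ^ 2 \<le> real l * real n"
    and l: "l \<le> n"
  shows "measure_pmf.prob (reach_pmf p n l) {..K} \<le> exp (- (real l ^ 2 / (4 * real K)))"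
proof -
  define \<theta> where "\<theta> = real l / (2 * real K)"
  define c where "c = \<theta>^2 / 2 + \<theta> * real K / real n"
  have n: "0 < real n" using K by simp
  have th: "0 \<le> \<theta>" by (simp add: \<theta>_def)
  have e1: "1 - exp (- \<theta>) \<le> \<theta>" using exp_ge_add_one_self[of "-\<theta>"] by simp
  \<comment> \<open>The product of 1 + \<theta> + \<theta>^2 / 2 and 1 - \<theta> + \<theta>^2 / 2
    is at least 1, and the first factor is at most exp \<theta>.\<close>
  have e2: "\<theta> - \<theta>^2 / 2 \<le> 1 - exp (-\<theta>)"
  proof -
    have "1 \<le> (1 + \<theta> + \<theta>^2 / 2) * (1 - \<theta> + \<theta>^2 / 2)"
    proof -
      have "(1 + \<theta> + \<theta>^2 / 2) * (1 - \<theta> + \<theta>^2 / 2) = 1 + (\<theta>^2 / 2)^2"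
        by (simp add: algebra_simps power2_eq_square)
      then show ?thesis by simp
    qed
    also have "\<dots> \<le> exp \<theta> * (1 - \<theta> + \<theta>^2 / 2)"
    proof (rule mult_right_mono)
      have "0 \<le> (\<theta> - 1)^2 + 1" by simp
      then show "0 \<le> 1 - \<theta> + \<theta>^2 / 2" by (simp add: power2_eq_square algebra_simps)
    qed (use exp_lower_Taylor_quadratic[OF th] in simp)
    finally have "exp (-\<theta>) * 1 \<le> exp (-\<theta>) * (exp \<theta> * (1 - \<theta> + \<theta>^2 / 2))"
      by (intro mult_left_mono) auto
    then have "exp (-\<theta>) \<le> 1 - \<theta> + \<theta>^2 / 2"
      by (simp add: mult.assoc[symmetric] exp_add[symmetric])
    then show ?thesis by simp
  qed
  have e0: "0 \<le> 1 - exp (- \<theta>)" using th by simp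
  have "(1 - real K / real n) * (1 - exp (-\<theta>)) \<le> p * real (n - K) * (1 - exp (-\<theta>))"
  proof (rule mult_right_mono[OF _ e0])
    have "1 - real K / real n \<le> (real n * p) * (1 - real K / real n)"
      using p(3) K n by (simp add: mult_le_cancel_right1 divide_le_eq)
    also have "\<dots> = p * real (n - K)" using K n by (simp add: field_simps of_nat_diff)
    finally show "1 - real K / real n \<le> p * real (n - K)" .
  qed
  moreover have "\<theta> - (1 - real K / real n) * (1 - exp (-\<theta>)) \<le> c"
  proof -
    have "real K / real n * (1 - exp (-\<theta>)) \<le> real K / real n * \<theta>"
      using e1 by (intro mult_left_mono) auto
    then show ?thesis unfolding c_def using e2 by (simp add: algebra_simps)
  qed
  ultimately have cc: "\<theta> - p * real (n - K) * (1 - exp (-\<theta>)) \<le> c" by linarith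
  have "measure_pmf.prob (reach_pmf p n l) {..K} \<le> exp (- \<theta> * real l + c * real K)"
    using K l th by (intro prob_reach_pmf_atMost_le p cc) (auto simp: c_def)
  also have "- \<theta> * real l + c * real K = - (3 * real l ^ 2 / (8 * real K)) + real l * real K / (2 * real n)"
    unfolding c_def \<theta>_def using K n by (simp add: field_simps power2_eq_square)
  also have "\<dots> \<le> - (real l ^ 2 / (4 * real K))"
  proof -
    have "real l * (4 * real K ^ 2) \<le> real l * (real l * real n)" using K(3) by (intro mult_left_mono) auto
    then have "real l * real K / (2 * real n) \<le> real l ^ 2 / (8 * real K)"
      using K n by (simp add: field_simps power2_eq_square)
    then show ?thesis using K by (simp add: field_simps)
  qed
  finally show ?thesis by simp
qed

text \<open>Taylor expansion with remainder of third order. This precision is required because the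
  drift estimate for the exploration is an equality to first order and is decided at order
  y^2.\<close>

lemma exp_bounds_small:
  fixes y :: real
  assumes "0 < y" "y \<le> 1/1000"
  shows "exp y \<le> 1 + y + y^2 / 2 + y^3" "exp (- 2 * y) \<ge> 1 - 2 * y + 2 * y^2 - 2 * y^3"
proof -
  have e: "exp t \<le> 3/2" if "\<bar>t\<bar> \<le> 1/100" for t :: real
  proof -
    have "exp t \<le> exp (1/100)" using that by simp
    also have "\<dots> \<le> 1 + 1/100 + (1/100)^2" by (rule exp_bound) auto
    finally show ?thesis by (simp add: power2_eq_square)
  qed
  have y3: "0 \<le> y^3" using assms by simp
  obtain t where t: "\<bar>t\<bar> \<le> \<bar>y\<bar>" "exp y = (\<Sum>m<3. y ^ m / fact m) + exp t / fact 3 * y ^ 3"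
    using Maclaurin_exp_le[of y 3] by blast
  have "exp t / fact 3 * y^3 \<le> 1 * y^3"
    using e[of t] t(1) assms y3 by (intro mult_right_mono) (auto simp: eval_nat_numeral)
  then show "exp y \<le> 1 + y + y^2 / 2 + y^3" using t(2) by (simp add: eval_nat_numeral)
  obtain u where u: "\<bar>u\<bar> \<le> \<bar>- 2 * y\<bar>" "exp (- 2 * y) = (\<Sum>m<3. (- 2 * y) ^ m / fact m) + exp u / fact 3 * (- 2 * y) ^ 3"
    using Maclaurin_exp_le[of "- 2 * y" 3] by blast
  have "exp u * (4/3) * y^3 \<le> 2 * y^3"
    using e[of u] u(1) assms y3 by (intro mult_right_mono) auto
  then show "exp (- 2 * y) \<ge> 1 - 2 * y + 2 * y^2 - 2 * y^3" using u(2) by (simp add: eval_nat_numeral)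
qed

section \<open>The unconfined case\<close>

text \<open>The scaling from here on is \<open>s = n\<^sup>1\<^sup>/\<^sup>3\<close>, \<open>x = \<alpha> / 640\<close> with \<open>\<alpha> = sqrt A\<close>, and \<open>y = x / s\<close>, so that
  \<open>p = (1 + y / 4) / s ^ 3\<close> belongs to the parameter \<open>\<lambda> = x / 4\<close>. The weight \<open>g\<close> is used with
  \<open>a = y\<close> and \<open>b = 2 y\<close>.\<close>

lemma expectation_large_reach_le:
  fixes x s y :: real
  assumes x: "0 < x" and s: "0 < s" and n: "real n = s ^ 3" and y: "y = x / s" "y \<le> 1/1000" "10 / s ^ 3 \<le> y ^ 2"
    and xs: "1 \<le> x * s^2"
    and p: "p = (1 + y / 4) / s ^ 3" and k: "k = nat \<lfloor>8 * x * s^2\<rfloor>"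
  shows "measure_pmf.expectation (reach_pmf p n 1) (\<lambda>t. if 2 * k < t then real t else 0)
    \<le> 2 * exp (- 16 * x ^ 3) / y"
proof -
  have y0: "0 < y" using x s y by simp
  have s3: "0 < s ^ 3" using s by simp
  have y2: "y^2 \<le> 1/1000000" using y0 y(2) power_mono[of y "1/1000" 2] by (simp add: power_divide)
  have s3': "1 / s^3 \<le> y^2 / 10" using y(3) by simp
  have p01: "0 \<le> p" "p \<le> 1"
  proof -
    show "0 \<le> p" using p y0 s3 by simp
    have "1 / s^3 \<le> 1/10000000" using s3' y2 by linarith
    moreover have "p = (1 + y / 4) * (1 / s^3)" using p by simp
    ultimately have "p \<le> 2 * (1/10000000)" using y(2) y0 s3 by (simp only:) (intro mult_mono, auto)
    then show "p \<le> 1" by simp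
  qed
  have np: "real n * p = 1 + y / 4" using p n s3 by simp
  have kn1: "real k / real n \<ge> 8 * y - y^2 / 10" and kn2: "real k / real n \<le> 8 * y" and k7: "7 * x * s^2 \<le> real k"
  proof -
    have k': "8 * x * s^2 - 1 \<le> real k" "real k \<le> 8 * x * s^2" unfolding k using x by (linarith, intro of_nat_floor) simp
    have e: "8 * x * s^2 / s^3 = 8 * y" unfolding y(1) using s by (simp add: field_simps power2_eq_square power3_eq_cube)
    have "8 * y - 1 / s^3 \<le> real k / s^3"
      unfolding e[symmetric] diff_divide_distrib[symmetric] using k'(1) s3 by (intro divide_right_mono) auto
    then show "real k / real n \<ge> 8 * y - y^2 / 10" unfolding n using s3' by simp
    show "real k / real n \<le> 8 * y" unfolding n e[symmetric] using k'(2) s3 by (intro divide_right_mono) auto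
    show "7 * x * s^2 \<le> real k" using k' xs by simp
  qed
  have n0: "0 < real n" using n s3 by simp
  have kn: "k \<le> n"
  proof -
    have "real k / real n \<le> 1" using kn2 y by linarith
    then show ?thesis using n0 by (simp add: divide_le_eq)
  qed
  \<comment> \<open>Removing k vertices, a fraction of about 8 y, makes the rest subcritical: N p <=
    1 - 7 y although n p = 1 + y / 4.\<close>
  define N where "N = n - k"
  have Nk: "N + k = n" using kn by (simp add: N_def)
  have Np: "real N * p \<le> 1 - 7 * y"
  proof -
    have "real N * p = (real n * p) * (1 - real k / real n)"
      using kn n0 by (simp add: N_def of_nat_diff field_simps)
    also have "\<dots> \<le> (1 + y / 4) * (1 - (8 * y - y^2 / 10))"
      unfolding np using kn1 y0 by (intro mult_left_mono) auto
    also have "\<dots> = 1 - 7 * y - y * (3/4 + y * (19/10) - y^2 / 40)"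
      by (simp add: algebra_simps power2_eq_square)
    also have "\<dots> \<le> 1 - 7 * y"
    proof -
      have "0 \<le> 3/4 + y * (19/10) - y^2 / 40" using y0 y2 by linarith
      then have "0 \<le> y * (3/4 + y * (19/10) - y^2 / 40)" using y0 by (intro mult_nonneg_nonneg) auto
      then show ?thesis by linarith
    qed
    finally show ?thesis .
  qed
  have ey: "exp y - 1 \<le> y + y^2"
    using exp_bound[of y] y0 y(2) by simp
  have ediff: "exp y - exp (- (2 * y)) \<le> 3 * y - (3/2) * y^2 + 3 * y^3"
    using exp_bounds_small[OF y0 y(2)] by simp
  \<comment> \<open>To first order both sides are 3 y. At second order exp a - exp (- b) contributes
    (a^2 - b^2) / 2 = - (3/2) y^2, which outweighs the (3/4) y^2 caused by n p = 1 + y / 4 and the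
    y^2 / 10 from the other summand. This is where b > a is used.\<close>
  have drift: "real n * p * (exp y - exp (- (2 * y))) + 2 * real n * p^2 * (2 * y)^2 \<le> y + 2 * y"
  proof -
    have "2 * real n * p^2 * (2 * y)^2 = 8 * (1 + y/4)^2 * y^2 * (1 / s^3)"
    proof -
      have "2 * real n * p^2 * (2 * y)^2 = 8 * (real n * p) * p * y^2" by (simp add: power2_eq_square)
      then show ?thesis unfolding np unfolding p by (simp add: power2_eq_square)
    qed
    also have "\<dots> \<le> 8 * (1 + y/4)^2 * y^2 * (1 / 10000000)"
      using s3' y2 by (intro mult_left_mono) auto
    also have "\<dots> \<le> 8 * 2^2 * y^2 * (1 / 10000000)"
      using y0 y(2) by (intro mult_right_mono mult_left_mono power_mono) auto
    also have "\<dots> \<le> y^2 / 10" by simp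
    finally have 1: "2 * real n * p^2 * (2 * y)^2 \<le> y^2 / 10" .
    have "real n * p * (exp y - exp (- (2 * y))) \<le> (1 + y/4) * (3 * y - (3/2) * y^2 + 3 * y^3)"
      unfolding np using ediff y0 by (intro mult_left_mono) auto
    also have "\<dots> = 3 * y - y^2 * (3/4 - y * (21/8) - (3/4) * y^2)"
      by (simp add: field_simps power2_eq_square power3_eq_cube)
    also have "\<dots> \<le> 3 * y - y^2 * (1/2)"
      using y0 y2 y(2) by (intro diff_left_mono mult_left_mono) auto
    finally have "real n * p * (exp y - exp (- (2 * y))) \<le> 3 * y - y^2 * (1/2)" .
    then show ?thesis using 1 zero_le_power2[of y] by linarith
  qed
  have main: "measure_pmf.expectation (reach_pmf p (N + k) 1) (\<lambda>t. real (t - k))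
    \<le> exp (\<Sum>i<k. - y + real (N + i) * p * (exp y - 1)) * (exp (y * real 1) - exp (- (2 * y) * real 1)) / (y * (1 - real N * p))"
  proof (rule expectation_reach_pmf_excess_le[OF p01, of y "2 * y" n])
    have "p * (2 * y) \<le> 1 * (1/2)" using p01 y0 y(2) by (intro mult_mono) auto
    then show "p * (2 * y) \<le> 1/2" by simp
    show "real N * p < 1" using Np y0 by simp
    have "n \<noteq> 0" using n0 by simp
    then show "1 \<le> N + k" using Nk by simp
  qed (use y0 drift Nk in auto)
  \<comment> \<open>Over the k steps N + i averages to about n (1 - k / (2 n)), where k / (2 n) is
    about 4 y. The mean exponent is thus about (1/4 + 1 - 4) y^2, below - (5/2) y^2, and k >= 7 x
    s^2 yields - (35/2) x^3 in total.\<close>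
  have expo: "(\<Sum>i<k. - y + real (N + i) * p * (exp y - 1)) \<le> - 16 * x^3"
  proof -
    have gauss: "(\<Sum>i<k. real i) \<le> real k ^ 2 / 2"
      by (induction k) (auto simp: field_simps power2_eq_square)
    have "(\<Sum>i<k. - y + real (N + i) * p * (exp y - 1)) = - (real k * y) + p * (exp y - 1) * (real k * real N + (\<Sum>i<k. real i))"
    proof -
      have "(\<Sum>i<k. - y + real (N + i) * p * (exp y - 1)) = (\<Sum>i<k. (p * (exp y - 1) * real N - y) + p * (exp y - 1) * real i)"
        by (intro sum.cong) (simp_all add: algebra_simps)
      also have "\<dots> = real k * (p * (exp y - 1) * real N - y) + p * (exp y - 1) * (\<Sum>i<k. real i)"
        by (simp only: sum.distrib sum_distrib_left[symmetric] sum_constant card_lessThan)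
      finally show ?thesis by (simp add: algebra_simps)
    qed
    also have "\<dots> \<le> - (real k * y) + p * (exp y - 1) * (real k * real N + real k ^ 2 / 2)"
      using gauss p01 y0 by (intro add_left_mono mult_left_mono) auto
    also have "real k * real N + real k ^ 2 / 2 = real k * real n * (1 - real k / real n / 2)"
      using kn n0 by (simp add: N_def of_nat_diff field_simps power2_eq_square)
    also have "- (real k * y) + p * (exp y - 1) * (real k * real n * (1 - real k / real n / 2))
       = real k * ((real n * p) * (exp y - 1) * (1 - real k / real n / 2) - y)" by (simp add: algebra_simps)
    also have "\<dots> \<le> real k * (- (5/2) * y^2)"
    proof (rule mult_left_mono)
      have "(real n * p) * (exp y - 1) * (1 - real k / real n / 2) \<le> (1 + y / 4) * (y + y^2) * (1 - (8 * y - y^2 / 10) / 2)"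
        unfolding np using ey y0 kn1 kn2 y(2) by (intro mult_mono) auto
      also have "\<dots> = y - (5/2) * y^2 - y^2 * (1/4 + (47/10) * y + (15/16) * y^2 - y^3 / 80)"
        by (simp add: field_simps power2_eq_square power3_eq_cube)
      also have "\<dots> \<le> y - (5/2) * y^2"
      proof -
        have "y^3 \<le> 1" using y0 y(2) by (intro power_le_one) auto
        then have "0 \<le> 1/4 + (47/10) * y + (15/16) * y^2 - y^3 / 80" using y0 zero_le_power2[of y] by linarith
        then show ?thesis using y0 by simp
      qed
      finally show "(real n * p) * (exp y - 1) * (1 - real k / real n / 2) - y \<le> - (5/2) * y^2" by simp
    qed simp
    also have "\<dots> \<le> 7 * x * s^2 * (- (5/2) * y^2)"
      using k7 by (intro mult_right_mono_neg) auto
    also have "\<dots> = - (35/2) * x^3" unfolding y(1) using s by (simp add: field_simps power2_eq_square power3_eq_cube)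
    also have "\<dots> \<le> - 16 * x^3" using x by simp
    finally show ?thesis .
  qed
  \<comment> \<open>The threshold is 2 k because 2 k < t implies t <= 2 (t - k).\<close>
  have "measure_pmf.expectation (reach_pmf p n 1) (\<lambda>t. if 2 * k < t then real t else 0)
    \<le> measure_pmf.expectation (reach_pmf p n 1) (\<lambda>t. 2 * real (t - k))"
    using p01 by (intro integral_mono integrable_measure_pmf_finite finite_set_reach_pmf) auto
  also have "\<dots> = 2 * measure_pmf.expectation (reach_pmf p (N + k) 1) (\<lambda>t. real (t - k))" using Nk by simp
  also have "\<dots> \<le> 2 * (exp (- 16 * x^3) * (4 * y) / (y * (7 * y)))"
  proof (rule mult_left_mono[OF order_trans[OF main]])
    have e: "0 \<le> exp y - exp (- (2 * y))" "exp y - exp (- (2 * y)) \<le> 4 * y"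
    proof -
      show "0 \<le> exp y - exp (- (2 * y))" using y0 by simp
      have "y^3 \<le> y^2" using y0 y(2) by (simp add: power2_eq_square power3_eq_cube mult_le_cancel_left)
      moreover have "y^2 \<le> y * (1/1000)" using y0 y(2) by (simp add: power2_eq_square)
      ultimately show "exp y - exp (- (2 * y)) \<le> 4 * y" using ediff y0 by linarith
    qed
    show "exp (\<Sum>i<k. - y + real (N + i) * p * (exp y - 1)) * (exp (y * real 1) - exp (- (2 * y) * real 1)) / (y * (1 - real N * p))
      \<le> exp (- 16 * x^3) * (4 * y) / (y * (7 * y))"
      using e expo Np y0 by (intro frac_le mult_mono mult_left_mono) auto
  qed simp
  also have "\<dots> = (8/7) * (exp (- 16 * x^3) / y)" using y0 by (simp add: field_simps)
  also have "\<dots> \<le> 2 * (exp (- 16 * x^3) / y)" using y0 by (intro mult_right_mono) auto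
  finally show ?thesis by simp
qed

section \<open>The confined case\<close>

lemma sum_exp_decay_le:
  fixes s :: real
  assumes "1 \<le> s"
  shows "(\<Sum>l=m..n. exp (- real l / s)) \<le> 2 * s"
proof -
  let ?q = "exp (- 1 / s)"
  have q: "0 < ?q" "?q < 1" using assms by auto
  have "(\<Sum>l=m..n. exp (- real l / s)) = (\<Sum>l=m..n. ?q ^ l)"
    by (intro sum.cong) (auto simp: exp_of_nat_mult[symmetric])
  also have "\<dots> \<le> (\<Sum>l<Suc n. ?q ^ l)" using q by (intro sum_mono2) auto
  also have "\<dots> = (1 - ?q ^ Suc n) / (1 - ?q)" using q by (subst sum_gp_strict) auto
  also have "\<dots> \<le> 1 / (1 - ?q)" using q by (intro divide_right_mono) auto
  also have "\<dots> \<le> 1 / (1 / (2 * s))"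
  proof (rule divide_left_mono)
    have "1 + 1 / s \<le> exp (1 / s)" using exp_ge_add_one_self[of "1 / s"] by simp
    then have "?q \<le> 1 / (1 + 1 / s)" using assms by (simp add: exp_minus inverse_eq_divide frac_le add_pos_pos)
    also have "\<dots> = 1 - 1 / (s + 1)" using assms by (simp add: field_simps)
    also have "\<dots> \<le> 1 - 1 / (2 * s)" using assms by (simp add: frac_le)
    finally show "1 / (2 * s) \<le> 1 - ?q" by simp
    show "0 < (1 - ?q) * (1 / (2 * s))" using q assms by simp
  qed simp
  finally show ?thesis by simp
qed

text \<open>Put L = l / s and r = sqrt L, so that \<alpha> <= r. The expected number of strong sets
  of size l is at most exp (5 r^3) / l. Since K <= 16 x s^2 = \<alpha> s^2 / 40, confinement has
  probability at most exp (- 10 r^3); the constant 640 is chosen for this. Of the remaining exp (- 5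
  r^3), four fifths give the bound and the rest makes the sum over l geometric, with total at most 2
  s, which 1 / m <= 1 / s cancels.\<close>

lemma confined_strong_sum_le:
  fixes x s y \<alpha> :: real
  assumes al: "1 \<le> \<alpha>" "x = \<alpha> / 640" and s: "1 \<le> s" and n: "real n = s ^ 3" and y: "y = x / s" "y \<le> 1/1000"
    and p: "p = (1 + y / 4) / s ^ 3" "p \<le> 1" and K: "0 < K" "real K \<le> 16 * x * s^2" and m: "\<alpha>^2 * s < real m" "2 \<le> m"
    and B: "\<And>l. B l = (\<Sum>r=1..l-1. fact (l - 1) * real ((l - 2) choose (r - 1)) / fact r * (real r * real l ^ (r - 1))^2 * p ^ (l - 1 + r))"
  shows "(\<Sum>l=m..n. real (n choose l) * B l * measure_pmf.prob (reach_pmf p n l) {..K}) \<le> 2 * exp (- 4 * \<alpha>^3)"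
proof -
  have x: "0 < x" using al by simp
  have y0: "0 < y" using x s y by simp
  have s3: "0 < s ^ 3" using s by simp
  have p0: "0 \<le> p" using p y0 s3 by simp
  have np: "real n * p = 1 + y / 4" using p n s3 by simp
  have ms: "s \<le> real m"
  proof -
    have "1 * s \<le> \<alpha>^2 * s" using al s by (intro mult_right_mono) auto
    then show ?thesis using m by simp
  qed
  have Kn: "K \<le> n"
  proof -
    have "16 * x \<le> s" using y s by (simp add: divide_le_eq)
    then have "16 * x * s^2 \<le> s * s^2" by (rule mult_right_mono) simp
    then have "16 * x * s^2 \<le> s^3" by (simp add: power2_eq_square power3_eq_cube)
    then show ?thesis using K n by linarith
  qed
  have summand: "real (n choose l) * B l * measure_pmf.prob (reach_pmf p n l) {..K}
     \<le> exp (- 4 * \<alpha>^3) / s * exp (- real l / s) * (s / real m)" if l: "l \<in> {m..n}" for l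
  proof -
    define L where "L = real l / s"
    have lL: "real l = L * s" using s by (simp add: L_def)
    have LA: "\<alpha>^2 \<le> L" using l m s by (simp add: L_def pos_le_divide_eq)
    have L1: "1 \<le> L" using LA al by (meson one_le_power order_trans)
    have aL: "\<alpha> \<le> sqrt L" using LA by (simp add: real_le_rsqrt)
    define r where "r = sqrt L"
    have r: "r^2 = L" "1 \<le> r" "\<alpha> \<le> r" using L1 aL by (simp_all add: r_def)
    have l2: "2 \<le> l" "0 < real l" using l m by auto
    have r3: "r^3 = L * r" using r(1) by (simp add: power2_eq_square power3_eq_cube)
    have "real (n choose l) * B l \<le> (real n * p) ^ l / real l * exp (2 * sqrt (2 * real l ^ 3 * p))"
      unfolding B by (rule expected_strong_sets_le[OF p0 l2(1)])
    also have "\<dots> \<le> exp (r^3) / real l * exp (4 * r^3)"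
    proof (intro mult_mono divide_right_mono)
      have "(real n * p) ^ l \<le> exp (y / 4) ^ l"
        unfolding np using y0 exp_ge_add_one_self[of "y / 4"] by (intro power_mono) auto
      also have "\<dots> = exp (real l * (y / 4))" by (rule exp_of_nat_mult[symmetric])
      also have "real l * (y / 4) = L * (x / 4)" unfolding lL y(1) using s by simp
      also have "exp (L * (x / 4)) \<le> exp (r^3)"
        unfolding r3 using L1 al r by (intro iffD2[OF exp_le_cancel_iff] mult_left_mono) auto
      finally show "(real n * p) ^ l \<le> exp (r^3)" .
      have "2 * real l ^ 3 * p = 2 * L^3 * (1 + y / 4)" unfolding lL p using s by (simp add: power_mult_distrib)
      also have "\<dots> \<le> 2 * L^3 * 2" using y(2) y0 L1 by (intro mult_left_mono) auto
      also have "\<dots> = (2 * r^3)^2" unfolding r(1)[symmetric] by (simp add: power_mult_distrib power_mult[symmetric])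
      finally have "sqrt (2 * real l ^ 3 * p) \<le> 2 * r^3" using r by (intro real_le_lsqrt) auto
      then show "exp (2 * sqrt (2 * real l ^ 3 * p)) \<le> exp (4 * r^3)" by simp
    qed auto
    finally have c1: "real (n choose l) * B l \<le> exp (5 * r^3) / real l" by (simp add: exp_add[symmetric])
    have K2: "4 * real K ^ 2 \<le> real l * real n"
    proof -
      have "4 * real K ^ 2 \<le> 4 * (16 * x * s^2)^2" using K by (intro mult_left_mono power_mono) auto
      also have "\<dots> = (1024 * x^2) * s^4" by (simp add: power_mult_distrib power_mult[symmetric])
      also have "\<dots> \<le> L * s^4"
      proof (rule mult_right_mono)
        have \<alpha>_eq: "\<alpha> = 640 * x" using al(2) by simp
        have "1024 * x^2 \<le> \<alpha>^2" unfolding \<alpha>_eq by (simp add: power_mult_distrib)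
        then show "1024 * x^2 \<le> L" using LA by simp
      qed (use s in simp)
      also have "\<dots> = real l * real n" unfolding n lL by (simp add: power_Suc[symmetric] eval_nat_numeral)
      finally show ?thesis .
    qed
    have "measure_pmf.prob (reach_pmf p n l) {..K} \<le> exp (- (real l ^ 2 / (4 * real K)))"
      using np y0 l by (intro prob_reach_small_le p0 p K Kn K2) auto
    also have "\<dots> \<le> exp (- (10 * r^3))"
    proof -
      have "real l ^ 2 / (4 * (16 * x * s^2)) \<le> real l ^ 2 / (4 * real K)"
        using K x s by (intro divide_left_mono) auto
      moreover have "real l ^ 2 / (4 * (16 * x * s^2)) = 10 * L^2 / \<alpha>"
        unfolding lL al(2) using s al by (simp add: field_simps power_mult_distrib)
      moreover have "10 * L^2 / \<alpha> \<ge> 10 * L^2 / r" using r al by (intro divide_left_mono) auto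
      moreover have "10 * L^2 / r = 10 * r^3" unfolding r(1)[symmetric] using r by (simp add: field_simps eval_nat_numeral)
      ultimately show ?thesis by simp
    qed
    finally have c2: "measure_pmf.prob (reach_pmf p n l) {..K} \<le> exp (- (10 * r^3))" .
    have "real (n choose l) * B l * measure_pmf.prob (reach_pmf p n l) {..K} \<le> (exp (5 * r^3) / real l) * exp (- (10 * r^3))"
      using c1 c2 by (intro mult_mono) auto
    also have "\<dots> = exp (- 5 * r^3) / real l" by (simp add: exp_add[symmetric])
    also have "\<dots> \<le> exp (- 4 * \<alpha>^3 - L) / real m"
    proof (intro frac_le)
      have "\<alpha>^3 \<le> r^3" using r al by (intro power_mono) auto
      moreover have "L \<le> r^3" unfolding r3 using L1 r by simp
      ultimately show "exp (- 5 * r^3) \<le> exp (- 4 * \<alpha>^3 - L)" by simp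
    qed (use l m in auto)
    also have "\<dots> = exp (- 4 * \<alpha>^3) / s * exp (- real l / s) * (s / real m)"
    proof -
      have "exp (- 4 * \<alpha>^3 - L) = exp (- 4 * \<alpha>^3) * exp (- real l / s)"
        unfolding L_def by (simp add: exp_add[symmetric])
      then show ?thesis using s by simp
    qed
    finally show ?thesis .
  qed
  have "(\<Sum>l=m..n. real (n choose l) * B l * measure_pmf.prob (reach_pmf p n l) {..K})
    \<le> (\<Sum>l=m..n. exp (- 4 * \<alpha>^3) / s * exp (- real l / s) * (s / real m))"
    using summand by (intro sum_mono)
  also have "\<dots> = exp (- 4 * \<alpha>^3) / s * (\<Sum>l=m..n. exp (- real l / s)) * (s / real m)"
    by (simp only: sum_distrib_left sum_distrib_right)
  also have "\<dots> \<le> exp (- 4 * \<alpha>^3) / s * (2 * s) * 1"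
  proof (rule mult_mono)
    show "exp (- 4 * \<alpha>^3) / s * (\<Sum>l=m..n. exp (- real l / s)) \<le> exp (- 4 * \<alpha>^3) / s * (2 * s)"
      using sum_exp_decay_le[OF s] s by (intro mult_left_mono) auto
    show "s / real m \<le> 1" using ms m by (simp add: divide_le_eq)
  qed (use s in auto)
  also have "\<dots> = 2 * exp (- 4 * \<alpha>^3)" using s by simp
  finally show ?thesis .
qed

text \<open>The two cases are combined with threshold 2 k. The unconfined one contributes 4 * 640 =
  2560 times exp (- 16 x^3), where 16 x^3 = \<alpha>^3 / 16384000, and the confined one adds 2 to
  the constant.\<close>

lemma prob_large_strong_set_le:
  fixes \<alpha> x s y :: real
  assumes al: "1 \<le> \<alpha>" "x = \<alpha> / 640" and s: "1 \<le> s" and n: "real n = s ^ 3" and y: "y = x / s" "y \<le> 1/1000" "10 / s ^ 3 \<le> y ^ 2"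
    and xs: "1 \<le> x * s^2" and p: "p = (1 + y / 4) / s ^ 3" "p \<le> 1"
  shows "measure_pmf.prob (bernoulli_family (possible_arcs n) p) {\<omega>. \<exists>S\<subseteq>{1..n}. \<alpha>^2 * s < real (card S) \<and> strong \<omega> S}
    \<le> 2562 * exp (- (\<alpha>^3) / 16384000)"
proof -
  let ?M = "bernoulli_family (possible_arcs n) p"
  define m where "m = nat \<lfloor>\<alpha>^2 * s\<rfloor> + 1"
  define k where "k = nat \<lfloor>8 * x * s^2\<rfloor>"
  have x: "0 < x" using al by simp
  have y0: "0 < y" using x s y by simp
  have s3: "0 < s ^ 3" using s by simp
  have p0: "0 \<le> p" using p y0 s3 by simp
  have np: "real n * p = 1 + y / 4" using p n s3 by simp
  have as: "1 \<le> \<alpha>^2 * s"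
  proof -
    have "1 * 1 \<le> \<alpha>^2 * s" using al s by (intro mult_mono) auto
    then show ?thesis by simp
  qed
  have m: "\<alpha>^2 * s < real m" "2 \<le> m" using as unfolding m_def by linarith+
  have mI: "m \<le> c" if "\<alpha>^2 * s < real c" for c
  proof -
    have "\<lfloor>\<alpha>^2 * s\<rfloor> < int c" using that by (simp add: floor_less_iff)
    then show ?thesis using as unfolding m_def by linarith
  qed
  have k: "0 < 2 * k" "real (2 * k) \<le> 16 * x * s^2"
  proof -
    have "real k \<le> 8 * x * s^2" unfolding k_def using x by (intro of_nat_floor) simp
    then show "real (2 * k) \<le> 16 * x * s^2" by simp
    have "1 \<le> 8 * x * s^2" using xs by simp
    then show "0 < 2 * k" unfolding k_def by linarith
  qed
  define B where "B l = (\<Sum>r=1..l-1. fact (l - 1) * real ((l - 2) choose (r - 1)) / fact r * (real r * real l ^ (r - 1))^2 * p ^ (l - 1 + r))" for l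
  have "measure_pmf.prob ?M {\<omega>. \<exists>S\<subseteq>{1..n}. \<alpha>^2 * s < real (card S) \<and> strong \<omega> S}
    \<le> measure_pmf.prob ?M {\<omega>. \<exists>S\<subseteq>{1..n}. m \<le> card S \<and> strong \<omega> S}"
    using mI by (intro measure_pmf.finite_measure_mono) auto
  also have "\<dots> \<le> real n * p * measure_pmf.expectation (reach_pmf p n 1) (\<lambda>t. if 2 * k < t then real t else 0) / real m
      + (\<Sum>l=m..n. real (n choose l) * B l * measure_pmf.prob (reach_pmf p n l) {..2 * k})"
  proof (rule prob_exists_strong_le[OF p0 p(2) m(2)])
    fix S l assume S: "S \<subseteq> {1..n}" "card S = l" "m \<le> l"
    then show "measure_pmf.prob ?M {\<omega>. strong \<omega> S} \<le> B l"
      unfolding B_def using m(2) finite_subset[OF S(1)] by (intro prob_strong_le finite_possible_arcs p0 p(2)) auto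
  qed
  also have "\<dots> \<le> 2560 * exp (- 16 * x^3) + 2 * exp (- 4 * \<alpha>^3)"
  proof (rule add_mono)
    have "real n * p * measure_pmf.expectation (reach_pmf p n 1) (\<lambda>t. if 2 * k < t then real t else 0) / real m
       \<le> 2 * (2 * exp (- 16 * x^3) / y) / (\<alpha>^2 * s)"
    proof (intro frac_le mult_mono)
      show "measure_pmf.expectation (reach_pmf p n 1) (\<lambda>t. if 2 * k < t then real t else 0) \<le> 2 * exp (- 16 * x^3) / y"
        by (rule expectation_large_reach_le) (use x s n y xs p k_def in auto)
      show "real n * p \<le> 2" using np y(2) by linarith
      show "0 \<le> measure_pmf.expectation (reach_pmf p n 1) (\<lambda>t. if 2 * k < t then real t else 0)"
        by (intro Bochner_Integration.integral_nonneg) auto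
    qed (use m as y0 in auto)
    also have "\<dots> = 4 * exp (- 16 * x^3) * (640 / \<alpha>^3)"
      unfolding y(1) al(2) using s al by (simp add: field_simps power2_eq_square power3_eq_cube)
    also have "\<dots> \<le> 4 * exp (- 16 * x^3) * (640 / 1)"
      using al by (intro mult_left_mono divide_left_mono) (auto intro: one_le_power)
    finally show "real n * p * measure_pmf.expectation (reach_pmf p n 1) (\<lambda>t. if 2 * k < t then real t else 0) / real m \<le> 2560 * exp (- 16 * x^3)"
      by simp
    show "(\<Sum>l=m..n. real (n choose l) * B l * measure_pmf.prob (reach_pmf p n l) {..2 * k}) \<le> 2 * exp (- 4 * \<alpha>^3)"
      by (rule confined_strong_sum_le[OF al s n y(1,2) p k m B_def])
  qed
  also have "\<dots> \<le> 2560 * exp (- (\<alpha>^3) / 16384000) + 2 * exp (- (\<alpha>^3) / 16384000)"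
  proof (intro add_mono mult_left_mono)
    show "exp (- 16 * x^3) \<le> exp (- (\<alpha>^3) / 16384000)" unfolding al(2) by (simp add: power_divide)
    have "0 \<le> \<alpha>^3" using al by simp
    then show "exp (- 4 * \<alpha>^3) \<le> exp (- (\<alpha>^3) / 16384000)" by simp
  qed auto
  finally show ?thesis by simp
qed

section \<open>Transfer to the random digraph and conclusion\<close>

lemma random_digraph_large_scc_le:
  assumes n: "1 \<le> n" and p: "0 \<le> p" "p \<le> p'" "p' \<le> 1"
  shows "measure_pmf.prob (random_digraph n p) {G. real (largest_scc_size G) > z}
    \<le> measure_pmf.prob (bernoulli_family (possible_arcs n) p') {\<omega>. \<exists>S\<subseteq>{1..n}. z < real (card S) \<and> strong \<omega> S}"
proof -
  have "measure_pmf.prob (random_digraph n p) {G. real (largest_scc_size G) > z}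
    \<le> measure_pmf.prob (bernoulli_family (possible_arcs n) p) {\<omega>. \<exists>S\<subseteq>{1..n}. z < real (card S) \<and> strong \<omega> S}"
    unfolding random_digraph_def measure_map_pmf
  proof (intro measure_pmf.finite_measure_mono subsetI)
    fix \<omega> assume "\<omega> \<in> (\<lambda>present. \<lparr> pverts = {1..n}, parcs = {e \<in> possible_arcs n. present e} \<rparr>) -` {G. real (largest_scc_size G) > z}"
    moreover obtain S where "S \<subseteq> {1..n}" "card S = largest_scc_size \<lparr> pverts = {1..n}, parcs = {e \<in> possible_arcs n. \<omega> e} \<rparr>" "strong \<omega> S"
      using largest_scc_size_strong[OF n refl] by blast
    ultimately show "\<omega> \<in> {\<omega>. \<exists>S\<subseteq>{1..n}. z < real (card S) \<and> strong \<omega> S}" by auto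
  qed simp
  \<comment> \<open>The existence of a large strong set is preserved by adding arcs, so the coupling
    allows raising \<open>p\<close> to \<open>p'\<close>.\<close>
  also have "\<dots> \<le> measure_pmf.prob (bernoulli_family (possible_arcs n) p') {\<omega>. \<exists>S\<subseteq>{1..n}. z < real (card S) \<and> strong \<omega> S}"
    using strong_mono by (intro prob_bernoulli_family_mono finite_possible_arcs p) blast
  finally show ?thesis .
qed

theorem theorem1p5:
  shows "\<exists>\<zeta> \<eta> :: real. \<zeta> > 0 \<and> \<eta> > 0 \<and>
    (\<forall>A lam :: real. A > 0 \<longrightarrow>
      (\<exists>N :: nat. \<forall>n \<ge> N.
        measure_pmf.prob (random_digraph n (1 / real n + lam * real n powr (- 4 / 3)))
            {G. real (largest_scc_size G) > A * real n powr (1 / 3)}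
          \<le> \<zeta> * exp (- \<eta> * A powr (3 / 2) + max lam 0 * A)))"
proof (rule exI[of _ 2562], rule exI[of _ "1 / 16384000"], intro conjI allI impI)
  let ?c = "1 / 16384000 :: real"
  fix A lam :: real assume A: "0 < A"
  define \<alpha> where "\<alpha> = sqrt A"
  have al0: "0 < \<alpha>" "\<alpha>^2 = A" using A by (simp_all add: \<alpha>_def)
  have A32: "A powr (3 / 2) = \<alpha>^3"
  proof -
    have "A powr (3/2) = (A powr (1/2)) powr 3" by (simp add: powr_powr)
    then show ?thesis using A al0(1) by (simp add: powr_half_sqrt \<alpha>_def)
  qed
  show "\<exists>N. \<forall>n\<ge>N. measure_pmf.prob (random_digraph n (1 / real n + lam * real n powr (- 4 / 3)))
        {G. real (largest_scc_size G) > A * real n powr (1 / 3)} \<le> 2562 * exp (- ?c * A powr (3 / 2) + max lam 0 * A)"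
  \<comment> \<open>In the first case the exponent is at least - 1, and 2562 / e exceeds 1. The
    bound \<alpha> / 2560 on \<open>lam\<close> is x / 4, the value that belongs to the arc
    probability \<open>p'\<close> used in the second case.\<close>
  proof (cases "A < 1 \<or> lam > \<alpha> / 2560")
    case True
    have "- 1 \<le> - ?c * A powr (3 / 2) + max lam 0 * A"
    proof (cases "A < 1")
      case True
      then have "\<alpha> < 1" by (simp add: \<alpha>_def)
      then have "\<alpha>^3 \<le> 1" using al0 by (intro power_le_one) auto
      moreover have "0 \<le> max lam 0 * A" using A by simp
      ultimately show ?thesis unfolding A32 by simp
    next
      case False
      then have "\<alpha> / 2560 * A \<le> max lam 0 * A" using True A by (intro mult_right_mono) auto
      moreover have "\<alpha>^3 = \<alpha> * A" using al0 by (simp add: power2_eq_square power3_eq_cube)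
      moreover have "0 \<le> \<alpha> * A" using al0 A by simp
      ultimately show ?thesis unfolding A32 by simp
    qed
    then have "exp (-1) \<le> exp (- ?c * A powr (3 / 2) + max lam 0 * A)" by (simp only: exp_le_cancel_iff)
    moreover have "1/4 \<le> exp (-1 :: real)"
      using exp_le by (simp add: exp_minus field_simps)
    ultimately have one: "1 \<le> 2562 * exp (- ?c * A powr (3 / 2) + max lam 0 * A)" by linarith
    show ?thesis
      by (intro exI[of _ 0] allI impI order_trans[OF measure_pmf.prob_le_1 one])
  next
    case False
    then have al: "1 \<le> \<alpha>" "lam \<le> \<alpha> / 2560" by (auto simp: \<alpha>_def)
    define x where "x = \<alpha> / 640"
    have x: "0 < x" using al by (simp add: x_def)
    \<comment> \<open>With s = n^(1/3) and y = x / s, the third condition amounts to 10 / s^3 <=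
      y^2, the fourth ensures 1 <= x s^2, and the last makes the arc probability
      nonnegative.\<close>
    have ev: "\<forall>\<^sub>F n in sequentially. 1 \<le> real n powr (1/3) \<and> x / real n powr (1/3) \<le> 1/1000 \<and> 10 / (x^2) \<le> real n powr (1/3)
      \<and> 1 / x \<le> real n powr (1/3) \<and> - lam \<le> real n powr (1/3)"
    proof (intro eventually_conj)
      have top: "filterlim (\<lambda>n. real n powr (1/3)) at_top sequentially" by real_asymp
      have ge: "\<forall>\<^sub>F n in sequentially. c \<le> real n powr (1/3)" for c
        using top by (simp add: filterlim_at_top)
      show "\<forall>\<^sub>F n in sequentially. 1 \<le> real n powr (1/3)" "\<forall>\<^sub>F n in sequentially. 10 / (x^2) \<le> real n powr (1/3)"
        "\<forall>\<^sub>F n in sequentially. 1 / x \<le> real n powr (1/3)" "\<forall>\<^sub>F n in sequentially. - lam \<le> real n powr (1/3)" by (rule ge)+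
      show "\<forall>\<^sub>F n in sequentially. x / real n powr (1/3) \<le> 1/1000"
        using ge[of "1 + 1000 * x"]
      proof eventually_elim
        case (elim n)
        then have "1000 * x \<le> real n powr (1/3)" "0 < real n powr (1/3)" using x by linarith+
        then show ?case by (simp add: divide_le_eq)
      qed
    qed
    then obtain N where N: "\<And>n. n \<ge> N \<Longrightarrow> 1 \<le> real n powr (1/3) \<and> x / real n powr (1/3) \<le> 1/1000 \<and> 10 / (x^2) \<le> real n powr (1/3)
      \<and> 1 / x \<le> real n powr (1/3) \<and> - lam \<le> real n powr (1/3)"
      unfolding eventually_sequentially by blast
    show ?thesis
    proof (intro exI[of _ N] allI impI)
      fix n assume "N \<le> n"
      define s where "s = real n powr (1/3)"
      define y where "y = x / s"
      define p' where "p' = (1 + y / 4) / s ^ 3"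
      have s: "1 \<le> s" "y \<le> 1/1000" "10 / x^2 \<le> s" "1 / x \<le> s" "- lam \<le> s"
        using N[OF \<open>N \<le> n\<close>] unfolding y_def s_def by blast+
      have n1: "1 \<le> n" using s(1) unfolding s_def by (cases n) auto
      have n3: "real n = s ^ 3" unfolding s_def using n1 by (simp add: powr_power)
      have n43: "real n powr (- 4 / 3) = 1 / s ^ 4"
      proof -
        have "s ^ 4 = real n powr (4/3)" unfolding s_def using n1 by (simp add: powr_power)
        then show ?thesis by (simp add: powr_minus_divide)
      qed
      have s3: "1 \<le> s^3" using s(1) by (rule one_le_power)
      let ?p = "1 / real n + lam * real n powr (- 4 / 3)"
      have p_eq: "?p = (1 + lam / s) / s^3" unfolding n3 using n43 s(1) by (simp add: n3[symmetric] add_divide_distrib) (simp add: n3 eval_nat_numeral)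
      have y0: "0 < y" using x s(1) by (simp add: y_def)
      have p: "0 \<le> ?p" "?p \<le> p'" "p' \<le> 1"
      proof -
        have "- 1 \<le> lam / s" using s by (simp add: pos_le_divide_eq)
        then show "0 \<le> ?p" unfolding p_eq using s3 s(1) by (intro divide_nonneg_nonneg) auto
        have "lam / s \<le> (\<alpha> / 2560) / s" using al(2) s(1) by (intro divide_right_mono) auto
        then have "lam / s \<le> y / 4" unfolding y_def x_def by simp
        then show "?p \<le> p'" unfolding p_eq p'_def using s(1) by (intro divide_right_mono) auto
        have y2: "y^2 \<le> 1/1000000" using y0 s(2) power_mono[of y "1/1000" 2] by (simp add: power_divide)
        have "1000 * x \<le> s" using s(1,2) by (simp add: y_def divide_le_eq)
        have "s * 1 \<le> s * s^2" using s(1) by (intro mult_left_mono) auto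
        then have "s \<le> s^3" by (simp add: power2_eq_square power3_eq_cube)
        have "5/4 \<le> 1000 * x" using al(1) by (simp add: x_def)
        then have "5/4 \<le> s^3" using \<open>1000 * x \<le> s\<close> \<open>s \<le> s^3\<close> by linarith
        moreover have "1 + y / 4 \<le> 5/4" using s(2) by linarith
        ultimately show "p' \<le> 1" unfolding p'_def using s3 s(1) by (subst divide_le_eq) auto
      qed
      have y10: "10 / s ^ 3 \<le> y ^ 2"
      proof -
        have "10 \<le> x^2 * s" using s(3) x by (simp add: divide_le_eq mult.commute)
        then show ?thesis unfolding y_def using s(1) by (simp add: field_simps power2_eq_square power3_eq_cube)
      qed
      have xs: "1 \<le> x * s^2"
      proof -
        have "1 \<le> x * s" using s(4) x by (simp add: divide_le_eq mult.commute)
        also have "\<dots> \<le> x * s^2" using x s(1) by (intro mult_left_mono self_le_power) auto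
        finally show ?thesis .
      qed
      have "measure_pmf.prob (random_digraph n ?p) {G. real (largest_scc_size G) > A * real n powr (1 / 3)}
        \<le> measure_pmf.prob (bernoulli_family (possible_arcs n) p') {\<omega>. \<exists>S\<subseteq>{1..n}. \<alpha>^2 * s < real (card S) \<and> strong \<omega> S}"
        unfolding al0(2) s_def by (rule random_digraph_large_scc_le[OF n1 p])
      also have "\<dots> \<le> 2562 * exp (- (\<alpha>^3) / 16384000)"
        by (rule prob_large_strong_set_le[OF al(1) x_def s(1) n3 y_def s(2) y10 xs p'_def p(3)])
      also have "\<dots> \<le> 2562 * exp (- ?c * A powr (3 / 2) + max lam 0 * A)"
        unfolding A32 using A by simp
      finally show "measure_pmf.prob (random_digraph n ?p) {G. real (largest_scc_size G) > A * real n powr (1 / 3)}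
        \<le> 2562 * exp (- ?c * A powr (3 / 2) + max lam 0 * A)" .
    qed
  qed
qed auto

end
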